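(* For all integers $N,d\ge 2$, \[ \sup_{\rho\in \mathrm{BOS}_N^{(2)}(d)}\ \inf_{\tau\in \mathrm{SEP}_{\mathrm H}^{(2)}(d)}\ \tfrac12\|\rho-\tau\|_1\ \le\ \frac{\sqrt{d-1}}{2(N-1)} . \]
   Context: $\mathrm D(\mathcal H)$ denotes the density operators on a finite-dimensional complex Hilbert space $\mathcal H$, and $\|\cdot\|_1$ is the trace norm. $\mathrm{Sym}^N(\mathbb C^d)\subseteq(\mathbb C^d)^{\otimes N}$ is the symmetric subspace, i.e. the vectors fixed by all permutations of the tensor factors. For a state $\rho_N$ on $(\mathbb C^d)^{\otimes N}$, $\rho_N^{(t)}$ is its marginal on the first $t$ tensor factors (partial trace over sites $t+1,\dots,N$). States in $\mathrm D(\mathrm{Sym}^N(\mathbb C^d))$ are regarded as states on $(\mathbb C^d)^{\otimes N}$ supported on the symmetric subspace. $\mathrm{BOS}_N^{(2)}(d):=\{\rho_N^{(2)}:\rho_N\in\mathrm D(\mathrm{Sym}^N(\mathbb C^d))\}$. $\mathrm{SEP}_{\mathrm H}^{(2)}(d):=\mathrm{conv}\{(|u\rangle\langle u|)^{\otimes 2}:u\in\mathbb C^d,\ \|u\|=1\}$ (Hartree mixtures). *)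

theory Defs
  imports
    Jordan_Normal_Form.Char_Poly
    Jordan_Normal_Form.Schur_Decomposition
    "HOL-Combinatorics.Permutations"
    "HOL-Library.Extended_Real"
begin

definition mat_trace :: "complex mat \<Rightarrow> complex" where
  "mat_trace A = (\<Sum>i<dim_row A. A $$ (i, i))"

text \<open>The trace norm is the sum of the singular values of \<open>A\<close>, i.e. of the square roots of the
  (real, nonnegative) eigenvalues of \<open>A\<^sup>* A\<close>, counted with multiplicity.\<close>

definition trace_norm :: "complex mat \<Rightarrow> real" where
  "trace_norm A = (\<Sum>x\<in>#proots (char_poly (mat_adjoint A * A)). sqrt (Re x))"

text \<open>The order on \<^typ>\<open>complex\<close> is that of \<^theory>\<open>HOL-Library.Complex_Order\<close>:
  \<open>0 \<le> z\<close> says that \<open>z\<close> is real and nonnegative.\<close>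

definition positive_semidefinite :: "nat \<Rightarrow> complex mat \<Rightarrow> bool" where
  "positive_semidefinite n A \<longleftrightarrow>
     A \<in> carrier_mat n n \<and> mat_adjoint A = A \<and> (\<forall>v\<in>carrier_vec n. 0 \<le> (A *\<^sub>v v) \<bullet>c v)"

definition density_operators :: "nat \<Rightarrow> complex mat set" where
  "density_operators n = {\<rho>. positive_semidefinite n \<rho> \<and> mat_trace \<rho> = 1}"

definition projector :: "complex vec \<Rightarrow> complex mat" where
  "projector u = mat (dim_vec u) (dim_vec u) (\<lambda>(i, j). u $ i * cnj (u $ j))"

text \<open>The type of matrices is not a real vector space, so the convex hull has to be spelled out
  as the set of all finite convex combinations.\<close>

definition mat_convex_hull :: "nat \<Rightarrow> complex mat set \<Rightarrow> complex mat set" where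
  "mat_convex_hull n S =
     {mat n n (\<lambda>(i, j). \<Sum>k<m. complex_of_real (p k) * A k $$ (i, j)) | (m::nat) p A.
        (\<forall>k<m. 0 \<le> p k \<and> A k \<in> S) \<and> (\<Sum>k<m. p k) = (1::real)}"

text \<open>\<open>(\<complex>\<^sup>d)\<^sup>\<otimes>\<^sup>N\<close> is \<open>carrier_vec (d ^ N)\<close>, its product basis being ordered as for the Kronecker
  product: the basis vector \<open>e\<^bsub>f 0\<^esub> \<otimes> \<dots> \<otimes> e\<^bsub>f (N - 1)\<^esub>\<close> has the number with base-\<open>d\<close> digits
  \<open>f 0, \<dots>, f (N - 1)\<close> (most significant first) as its index. Sites are counted from 0.\<close>

definition basis_index :: "nat \<Rightarrow> nat \<Rightarrow> (nat \<Rightarrow> nat) \<Rightarrow> nat" where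
  "basis_index d N f = (\<Sum>k<N. f k * d ^ (N - 1 - k))"

definition site :: "nat \<Rightarrow> nat \<Rightarrow> nat \<Rightarrow> nat \<Rightarrow> nat" where
  "site d N i k = (i div d ^ (N - 1 - k)) mod d"

definition kron :: "complex mat \<Rightarrow> complex mat \<Rightarrow> complex mat" where
  "kron A B = mat (dim_row A * dim_row B) (dim_col A * dim_col B)
     (\<lambda>(i, j). A $$ (i div dim_row B, j div dim_col B) * B $$ (i mod dim_row B, j mod dim_col B))"

definition permute_sites :: "nat \<Rightarrow> nat \<Rightarrow> (nat \<Rightarrow> nat) \<Rightarrow> complex vec \<Rightarrow> complex vec" where
  "permute_sites d N \<pi> v = vec (d ^ N) (\<lambda>i. v $ basis_index d N (\<lambda>k. site d N i (\<pi> k)))"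

definition Sym :: "nat \<Rightarrow> nat \<Rightarrow> complex vec set" where
  "Sym d N = {v \<in> carrier_vec (d ^ N). \<forall>\<pi>. \<pi> permutes {..<N} \<longrightarrow> permute_sites d N \<pi> v = v}"

text \<open>The support of a positive semidefinite operator is its range.\<close>

definition density_operators_Sym :: "nat \<Rightarrow> nat \<Rightarrow> complex mat set" where
  "density_operators_Sym d N =
     {\<rho> \<in> density_operators (d ^ N). \<forall>v\<in>carrier_vec (d ^ N). \<rho> *\<^sub>v v \<in> Sym d N}"

text \<open>The partial trace over all sites but the first \<open>t\<close> (for \<open>t \<le> N\<close>): \<open>a\<close>, \<open>b\<close> index the
  product basis of the first \<open>t\<close> factors, \<open>c\<close> that of the remaining \<open>N - t\<close>.\<close>

definition marginal :: "nat \<Rightarrow> nat \<Rightarrow> nat \<Rightarrow> complex mat \<Rightarrow> complex mat" where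
  "marginal d N t \<rho> = mat (d ^ t) (d ^ t)
     (\<lambda>(a, b). \<Sum>c<d ^ (N - t). \<rho> $$ (a * d ^ (N - t) + c, b * d ^ (N - t) + c))"

definition BOS2 :: "nat \<Rightarrow> nat \<Rightarrow> complex mat set" where
  "BOS2 d N = marginal d N 2 ` density_operators_Sym d N"

definition SEP_H2 :: "nat \<Rightarrow> complex mat set" where
  "SEP_H2 d = mat_convex_hull (d ^ 2)
     {kron (projector u) (projector u) | u. u \<in> carrier_vec d \<and> u \<bullet>c u = 1}"

end

theory Submission
  imports "HOL-Analysis.Function_Topology" "HOL-Analysis.Topology_Euclidean_Space" Defs
begin

text \<open>Let \<open>Z\<close> be a Hermitian operator on two sites, and let \<open>\<psi>\<close> be a top eigenvector, with eigenvalue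
  \<open>\<mu>\<close>, of \<open>Z\<close> acting on two of \<open>N\<close> sites and compressed to the symmetric subspace. If the unit vector
  \<open>u\<close> maximises the overlap of \<open>\<psi>\<close> with \<open>u \<otimes> \<dots> \<otimes> u\<close>, then contracting \<open>\<psi>\<close> with \<open>u\<close> on all but two
  sites gives a multiple of \<open>u \<otimes> u + K\<close>, where \<open>K\<close> lives on the orthogonal complement of \<open>u\<close> and, by the
  second-order condition, has operator norm at most \<open>1 / (N - 1)\<close>; hence its Hilbert-Schmidt norm is at
  most \<open>sqrt (d - 1) / (N - 1)\<close>. The eigenvalue equation yields \<open>\<mu> = \<langle>u \<otimes> u, Z (u \<otimes> u + K)\<rangle>\<close>, which
  bounds the expectation of \<open>Z\<close> in every state of \<open>BOS2\<close> by its expectation in the projector onto \<open>u \<otimes> u\<close>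
  plus the Hermitian part of the dyad of \<open>u \<otimes> u\<close> and \<open>K\<close>, an operator whose trace norm is at most the norm
  of \<open>K\<close>. Instead of the minimax theorem, a Frank-Wolfe iteration over the choice of \<open>Z\<close> then produces the
  approximating Hartree mixture.\<close>

section \<open>Hermitian forms\<close>

text \<open>The eigenvalue equation is tested against a tensor power on one side only, so
  \<open>K\<close> enters linearly and the error is governed by its norm. The bound on
  \<open>K\<close> comes from the second-order terms along \<open>u + t v\<close>:
  \<open>(N choose 2)\<close> times the contracted form is compared with \<open>N |v|^2 / 2\<close>
  from the growth of the norm. The form is symmetric and antilinear in both arguments, so its
  diagonal values control its operator norm without loss.

  Since \<open>u\<close> and \<open>K\<close> depend on \<open>Z\<close>, the bound alone does not
  approximate the marginal. The iteration aims at the convex hull of the sums of a Hartree projector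
  and its Hermitian dyad. Each point of this hull lies within \<open>sqrt (d - 1) / (N - 1)\<close>
  of a Hartree mixture in trace norm, and the hull need only be approached in Hilbert-Schmidt norm,
  where dimension-dependent constants are harmless.

  Vectors are sequences; requiring the tail to vanish makes the unit sphere compact in the product
  topology, as both maximisations need. Maximising a quadratic form over a closed subspace gives the
  top eigenvector of the compression and, iterated, the spectral theorem behind
  \<open>trace_norm\<close>.\<close>

definition inner_prod :: "nat \<Rightarrow> (nat \<Rightarrow> complex) \<Rightarrow> (nat \<Rightarrow> complex) \<Rightarrow> complex" where
  "inner_prod n x y = (\<Sum>i<n. cnj (x i) * y i)"

definition norm_sq :: "nat \<Rightarrow> (nat \<Rightarrow> complex) \<Rightarrow> real" where
  "norm_sq n x = (\<Sum>i<n. (cmod (x i))\<^sup>2)"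

text \<open>The value 0 beyond \<open>n\<close> keeps results among the sequences with vanishing
  tail, so that eigenvalue equations can be stated as equalities of functions.\<close>

definition apply_op :: "nat \<Rightarrow> (nat \<Rightarrow> nat \<Rightarrow> complex) \<Rightarrow> (nat \<Rightarrow> complex) \<Rightarrow> nat \<Rightarrow> complex" where
  "apply_op n A x i = (if i < n then \<Sum>j<n. A i j * x j else 0)"

definition herm :: "nat \<Rightarrow> (nat \<Rightarrow> nat \<Rightarrow> complex) \<Rightarrow> bool" where
  "herm n A \<longleftrightarrow> (\<forall>i<n. \<forall>j<n. A i j = cnj (A j i))"

lemma inner_prod_self: "inner_prod n x x = complex_of_real (norm_sq n x)"
  unfolding inner_prod_def norm_sq_def
  by (simp only: of_real_sum complex_norm_square mult.commute)

lemma norm_sq_nonneg [simp]: "0 \<le> norm_sq n x"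
  by (simp add: norm_sq_def sum_nonneg)

lemma norm_sq_eq_0_iff: "norm_sq n x = 0 \<longleftrightarrow> (\<forall>i<n. x i = 0)"
  unfolding norm_sq_def by (subst sum_nonneg_eq_0_iff) auto

lemma cmod_sq_le_norm_sq: "i < n \<Longrightarrow> (cmod (x i))\<^sup>2 \<le> norm_sq n x"
  unfolding norm_sq_def by (rule member_le_sum) auto

lemma norm_sq_scale: "norm_sq n (\<lambda>i. c * x i) = (cmod c)\<^sup>2 * norm_sq n x"
  by (simp add: norm_sq_def norm_mult power_mult_distrib sum_distrib_left)

lemma inner_prod_cnj: "cnj (inner_prod n x y) = inner_prod n y x"
  by (simp add: inner_prod_def mult.commute)

lemma inner_prod_add_right: "inner_prod n x (\<lambda>i. y i + z i) = inner_prod n x y + inner_prod n x z"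
  by (simp add: inner_prod_def algebra_simps sum.distrib)

lemma inner_prod_add_left: "inner_prod n (\<lambda>i. y i + z i) x = inner_prod n y x + inner_prod n z x"
  by (simp add: inner_prod_def algebra_simps sum.distrib)

lemma inner_prod_diff_right: "inner_prod n x (\<lambda>i. y i - z i) = inner_prod n x y - inner_prod n x z"
  by (simp add: inner_prod_def algebra_simps sum_subtractf)

lemma inner_prod_scale_right: "inner_prod n x (\<lambda>i. c * y i) = c * inner_prod n x y"
  by (simp add: inner_prod_def sum_distrib_left algebra_simps)

lemma inner_prod_scale_left: "inner_prod n (\<lambda>i. c * y i) x = cnj c * inner_prod n y x"
  by (simp add: inner_prod_def sum_distrib_left algebra_simps)

lemma inner_prod_sum_right:
  "inner_prod n x (\<lambda>i. \<Sum>k\<in>I. f k i) = (\<Sum>k\<in>I. inner_prod n x (f k))"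
  unfolding inner_prod_def sum_distrib_left by (subst sum.swap) simp

lemma inner_prod_sum_left:
  "inner_prod n (\<lambda>i. \<Sum>k\<in>I. f k i) x = (\<Sum>k\<in>I. inner_prod n (f k) x)"
  unfolding inner_prod_def cnj_sum sum_distrib_right by (subst sum.swap) simp

lemma inner_prod_apply_op:
  "inner_prod n x (apply_op n A y) = (\<Sum>i<n. \<Sum>j<n. cnj (x i) * A i j * y j)"
  by (simp add: inner_prod_def apply_op_def sum_distrib_left mult.assoc)

lemma herm_inner:
  assumes "herm n A"
  shows "inner_prod n (apply_op n A x) y = inner_prod n x (apply_op n A y)"
proof -
  have "inner_prod n (apply_op n A x) y = (\<Sum>i<n. \<Sum>j<n. cnj (A i j) * cnj (x j) * y i)"
    by (simp add: inner_prod_def apply_op_def sum_distrib_right)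
  also have "\<dots> = (\<Sum>j<n. \<Sum>i<n. cnj (A i j) * cnj (x j) * y i)"
    by (rule sum.swap)
  also have "\<dots> = (\<Sum>j<n. \<Sum>i<n. cnj (x j) * A j i * y i)"
  proof (intro sum.cong refl)
    fix i j assume "j \<in> {..<n}" "i \<in> {..<n}"
    hence "cnj (A i j) = A j i" using assms unfolding herm_def by (metis lessThan_iff)
    thus "cnj (A i j) * cnj (x j) * y i = cnj (x j) * A j i * y i" by simp
  qed
  finally show ?thesis by (simp add: inner_prod_apply_op)
qed

lemma inner_prod_apply_op_real:
  assumes "herm n A"
  shows "inner_prod n x (apply_op n A x) \<in> \<real>"
  unfolding Reals_cnj_iff inner_prod_cnj herm_inner[OF assms] ..

lemma apply_op_add: "apply_op n A (\<lambda>i. x i + y i) = (\<lambda>i. apply_op n A x i + apply_op n A y i)"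
  by (auto simp: apply_op_def fun_eq_iff algebra_simps sum.distrib)

lemma apply_op_scale: "apply_op n A (\<lambda>i. c * x i) = (\<lambda>i. c * apply_op n A x i)"
  by (auto simp: apply_op_def fun_eq_iff algebra_simps sum_distrib_left)

section \<open>Compactness of the unit sphere and maximisers of quadratic forms\<close>

definition unit_sphere :: "nat \<Rightarrow> (nat \<Rightarrow> complex) set" where
  "unit_sphere n = {x. (\<forall>i\<ge>n. x i = 0) \<and> norm_sq n x = 1}"

lemma continuous_on_coordinate: "continuous_on S (\<lambda>x::nat \<Rightarrow> complex. x i)"
  by (rule continuous_on_product_then_coordinatewise[OF continuous_on_id])

lemma continuous_on_norm_sq: "continuous_on S (norm_sq n)"
  unfolding norm_sq_def
  by (intro continuous_on_sum continuous_on_mult continuous_on_power continuous_on_norm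
      continuous_on_cnj continuous_on_const continuous_on_coordinate)

lemma continuous_on_inner_prod_apply_op: "continuous_on S (\<lambda>x. inner_prod n x (apply_op n A x))"
  unfolding inner_prod_apply_op
  by (intro continuous_on_sum continuous_on_mult continuous_on_power continuous_on_norm
      continuous_on_cnj continuous_on_const continuous_on_coordinate)

lemma continuous_on_inner_prod_right: "continuous_on S (inner_prod n y)"
  unfolding inner_prod_def
  by (intro continuous_on_sum continuous_on_mult continuous_on_power continuous_on_norm
      continuous_on_cnj continuous_on_const continuous_on_coordinate)

text \<open>The vanishing tail places the sphere inside a product of closed discs and singletons,
  which is compact by Tychonoff. The norm condition is closed because it reads finitely many
  coordinates.\<close>

lemma compact_unit_sphere: "compact (unit_sphere n)"
proof -
  define B where "B = (\<lambda>i::nat. if i < n then cball (0::complex) 1 else {0})"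
  have "compactin (product_topology (\<lambda>_. euclidean) UNIV) (PiE UNIV B)"
    by (subst compactin_PiE) (auto simp: B_def)
  hence c: "compact (PiE UNIV B)"
    by (simp add: euclidean_product_topology)
  have "closed {x::nat \<Rightarrow> complex. norm_sq n x = 1}"
    by (intro closed_Collect_eq continuous_on_norm_sq continuous_on_const)
  moreover have "unit_sphere n = PiE UNIV B \<inter> {x. norm_sq n x = 1}"
  proof -
    have "cmod (x i) \<le> 1" if "norm_sq n x = 1" "i < n" for x i
      using cmod_sq_le_norm_sq[of i n x] that by (simp add: power_le_one_iff)
    hence "x \<in> unit_sphere n \<longleftrightarrow> x \<in> PiE UNIV B \<inter> {x. norm_sq n x = 1}" for x
      unfolding unit_sphere_def B_def PiE_UNIV_domain by (auto simp: Pi_iff not_less)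
    thus ?thesis by blast
  qed
  ultimately show ?thesis using c by (simp add: compact_Int_closed)
qed

text \<open>For nonempty \<open>S\<close> the one closure condition suffices: \<open>y = x\<close>
  and \<open>c = -1\<close> give 0, and from 0 it gives all multiples.\<close>

definition closed_subspace :: "nat \<Rightarrow> (nat \<Rightarrow> complex) set \<Rightarrow> bool" where
  "closed_subspace n S \<longleftrightarrow> closed S \<and> (\<forall>x\<in>S. \<forall>i\<ge>n. x i = 0) \<and>
     (\<forall>x\<in>S. \<forall>y\<in>S. \<forall>c. (\<lambda>i. x i + c * y i) \<in> S)"

text \<open>The first-order condition at a maximiser of the quadratic form of \<open>A\<close> on the unit sphere of
  \<open>S\<close> says that the maximiser is an eigenvector of the compression of \<open>A\<close> to \<open>S\<close>.\<close>

lemma compression_top_eigenvector: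
  assumes A: "herm n A"
    and S: "closed_subspace n S"
    and ne: "x0 \<in> S" "norm_sq n x0 \<noteq> 0"
  shows "\<exists>\<mu> \<psi>. \<psi> \<in> S \<and> norm_sq n \<psi> = 1 \<and>
    (\<forall>\<phi>\<in>S. Re (inner_prod n \<phi> (apply_op n A \<phi>)) \<le> \<mu> * norm_sq n \<phi>) \<and>
    (\<forall>\<phi>\<in>S. inner_prod n \<phi> (apply_op n A \<psi>) = complex_of_real \<mu> * inner_prod n \<phi> \<psi>)"
proof -
  have cl: "closed S"
    and supp: "\<And>x i. x \<in> S \<Longrightarrow> n \<le> i \<Longrightarrow> x i = 0"
    and lin: "\<And>x y c. x \<in> S \<Longrightarrow> y \<in> S \<Longrightarrow> (\<lambda>i. x i + c * y i) \<in> S"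
    using S by (simp_all add: closed_subspace_def)
  have zero: "(\<lambda>i. 0) \<in> S"
    using lin[OF ne(1) ne(1), of "-1"] by simp
  have scale: "(\<lambda>i. c * x i) \<in> S" if "x \<in> S" for c x
    using lin[OF zero that, of c] by simp
  let ?q = "\<lambda>x. Re (inner_prod n x (apply_op n A x))"
  have normalize: "(\<lambda>i. complex_of_real (1 / sqrt (norm_sq n x)) * x i) \<in> S \<inter> unit_sphere n"
    if "x \<in> S" "norm_sq n x \<noteq> 0" for x
  proof -
    have "norm_sq n (\<lambda>i. complex_of_real (1 / sqrt (norm_sq n x)) * x i) = 1"
      unfolding norm_sq_scale norm_of_real using that by (simp add: power_divide)
    with supp[OF that(1)] scale[OF that(1), of "complex_of_real (1 / sqrt (norm_sq n x))"]
    show ?thesis by (simp add: unit_sphere_def)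
  qed
  have "compact (S \<inter> unit_sphere n)"
    by (metis Int_commute cl compact_Int_closed compact_unit_sphere)
  moreover have "S \<inter> unit_sphere n \<noteq> {}" using normalize[OF ne] by blast
  moreover have "continuous_on (S \<inter> unit_sphere n) ?q"
    by (intro continuous_on_Re continuous_on_inner_prod_apply_op)
  ultimately have "\<exists>x\<in>S \<inter> unit_sphere n. \<forall>y\<in>S \<inter> unit_sphere n. ?q y \<le> ?q x"
    by (rule continuous_attains_sup)
  then obtain \<psi> where \<psi>: "\<psi> \<in> S \<inter> unit_sphere n" "\<And>y. y \<in> S \<inter> unit_sphere n \<Longrightarrow> ?q y \<le> ?q \<psi>"
    by blast
  define \<mu> where "\<mu> = ?q \<psi>"
  have q\<psi>: "inner_prod n \<psi> (apply_op n A \<psi>) = \<mu>"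
    using inner_prod_apply_op_real[OF A, of \<psi>] unfolding \<mu>_def by (simp add: of_real_Re)
  have nrm: "norm_sq n \<psi> = 1" and \<psi>S: "\<psi> \<in> S" using \<psi>(1) by (auto simp: unit_sphere_def)
  have le: "?q \<phi> \<le> \<mu> * norm_sq n \<phi>" if "\<phi> \<in> S" for \<phi>
  proof (cases "norm_sq n \<phi> = 0")
    case True
    hence "?q \<phi> = 0" by (simp add: norm_sq_eq_0_iff inner_prod_def)
    with True show ?thesis by simp
  next
    case False
    let ?c = "complex_of_real (1 / sqrt (norm_sq n \<phi>))"
    have pos: "norm_sq n \<phi> > 0" using False norm_sq_nonneg[of n \<phi>] by linarith
    have "?q (\<lambda>i. ?c * \<phi> i) = ?q \<phi> / norm_sq n \<phi>"
      unfolding apply_op_scale inner_prod_scale_left inner_prod_scale_right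
      using pos by (simp flip: mult.assoc of_real_mult)
    moreover have "?q (\<lambda>i. ?c * \<phi> i) \<le> \<mu>"
      using \<psi>(2)[OF normalize[OF that False]] by (simp add: \<mu>_def)
    ultimately have "?q \<phi> / norm_sq n \<phi> \<le> \<mu>" by simp
    thus ?thesis using pos by (simp only: pos_divide_le_eq)
  qed
  have eq: "inner_prod n \<phi> (apply_op n A \<psi>) = \<mu> * inner_prod n \<phi> \<psi>" if "\<phi> \<in> S" for \<phi>
  proof -
    \<comment> \<open>\<open>\<beta>\<close> measures the failure of the eigenvalue equation against
      \<open>\<phi>\<close>, and \<open>\<gamma>\<close> is the slack of \<open>\<phi>\<close> in
      the maximality bound. Maximality at \<open>\<psi> + s \<phi>\<close> becomes an inequality
      without constant term, because \<open>\<psi>\<close> attains the bound.\<close>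
    define \<beta> where "\<beta> = \<mu> * inner_prod n \<phi> \<psi> - inner_prod n \<phi> (apply_op n A \<psi>)"
    define \<gamma> where "\<gamma> = \<mu> * norm_sq n \<phi> - ?q \<phi>"
    have ineq: "0 \<le> 2 * Re (cnj s * \<beta>) + (cmod s)\<^sup>2 * \<gamma>" for s
    proof -
      let ?x = "\<lambda>i. \<psi> i + s * \<phi> i"
      have "?q ?x \<le> \<mu> * norm_sq n ?x" by (rule le[OF lin[OF \<psi>S that]])
      hence "0 \<le> Re (\<mu> * inner_prod n ?x ?x - inner_prod n ?x (apply_op n A ?x))"
        by (simp add: inner_prod_self)
      also have "\<mu> * inner_prod n ?x ?x - inner_prod n ?x (apply_op n A ?x)
        = cnj s * \<beta> + s * cnj \<beta> + (s * cnj s) * (\<mu> * norm_sq n \<phi> - inner_prod n \<phi> (apply_op n A \<phi>))"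
        unfolding apply_op_add apply_op_scale inner_prod_add_left inner_prod_add_right
          inner_prod_scale_left inner_prod_scale_right \<beta>_def
        unfolding complex_cnj_diff complex_cnj_mult complex_cnj_complex_of_real inner_prod_cnj herm_inner[OF A]
          q\<psi> inner_prod_self nrm
        by (simp add: algebra_simps)
      also have "s * cnj s = (cmod s)\<^sup>2" by (rule complex_norm_square[symmetric])
      also have "Re (cnj s * \<beta> + s * cnj \<beta> + (cmod s)\<^sup>2 * (\<mu> * norm_sq n \<phi> - inner_prod n \<phi> (apply_op n A \<phi>)))
         = 2 * Re (cnj s * \<beta>) + (cmod s)\<^sup>2 * \<gamma>"
        unfolding \<gamma>_def plus_complex.simps Re_complex_of_real
        by (simp del: of_real_power add: times_complex.simps minus_complex.simps Re_complex_of_real Im_complex_of_real)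
      finally show ?thesis .
    qed
    have "\<gamma> \<ge> 0" using le[OF that] by (simp add: \<gamma>_def)
    \<comment> \<open>The direction \<open>s = - t \<beta>\<close> makes the linear term negative,
      and \<open>t * \<gamma> < 1\<close> keeps it dominant over the quadratic one, which forces
      \<open>\<beta> = 0\<close>.\<close>
    define t where "t = 1 / (1 + \<gamma>)"
    have t: "t > 0" "t * \<gamma> < 1" using \<open>\<gamma> \<ge> 0\<close> by (auto simp: t_def field_simps)
    have "0 \<le> 2 * Re (cnj (- t * \<beta>) * \<beta>) + (cmod (- t * \<beta>))\<^sup>2 * \<gamma>" by (rule ineq)
    also have "cnj (- t * \<beta>) * \<beta> = - t * (\<beta> * cnj \<beta>)" by simp
    also have "\<beta> * cnj \<beta> = (cmod \<beta>)\<^sup>2" by (rule complex_norm_square[symmetric])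
    also have "Re (- t * complex_of_real ((cmod \<beta>)\<^sup>2)) = - t * (cmod \<beta>)\<^sup>2"
      by (simp flip: of_real_mult of_real_power)
    also have "(cmod (- t * \<beta>))\<^sup>2 = t\<^sup>2 * (cmod \<beta>)\<^sup>2"
      by (simp add: norm_mult power_mult_distrib)
    also have "2 * (- t * (cmod \<beta>)\<^sup>2) + t\<^sup>2 * (cmod \<beta>)\<^sup>2 * \<gamma> = - (t * (2 - t * \<gamma>) * (cmod \<beta>)\<^sup>2)"
      by (simp add: power2_eq_square algebra_simps)
    finally have "t * (2 - t * \<gamma>) * (cmod \<beta>)\<^sup>2 \<le> 0" by linarith
    moreover have "t * (2 - t * \<gamma>) > 0" using t by (intro mult_pos_pos) auto
    ultimately have "(cmod \<beta>)\<^sup>2 \<le> 0" by (metis mult_pos_pos not_less)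
    thus ?thesis by (simp add: \<beta>_def)
  qed
  from \<psi>S nrm le eq show ?thesis by blast
qed

section \<open>Orthonormal systems and the spectral theorem\<close>

definition orthonormal :: "nat \<Rightarrow> nat \<Rightarrow> (nat \<Rightarrow> nat \<Rightarrow> complex) \<Rightarrow> bool" where
  "orthonormal n k v \<longleftrightarrow>
     (\<forall>i<k. \<forall>j<k. inner_prod n (v i) (v j) = (if i = j then 1 else 0))"

text \<open>For an orthonormal system this is the projection of the standard basis vector with index
  \<open>j\<close> onto the orthogonal complement of \<open>v 0, ..., v (k - 1)\<close>.\<close>

definition residual :: "nat \<Rightarrow> nat \<Rightarrow> (nat \<Rightarrow> nat \<Rightarrow> complex) \<Rightarrow> nat \<Rightarrow> nat \<Rightarrow> complex" where
  "residual n k v j m = (if m < n then (if m = j then 1 else 0) - (\<Sum>i<k. cnj (v i j) * v i m) else 0)"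

lemma inner_prod_residual:
  assumes "j < n"
  shows "inner_prod n x (residual n k v j) = cnj (x j) - (\<Sum>i<k. cnj (v i j) * inner_prod n x (v i))"
proof -
  have "inner_prod n x (residual n k v j)
    = inner_prod n x (\<lambda>m. (if m = j then 1 else 0) - (\<Sum>i<k. cnj (v i j) * v i m))"
    by (simp add: inner_prod_def residual_def)
  also have "\<dots> = inner_prod n x (\<lambda>m. if m = j then 1 else 0) - (\<Sum>i<k. cnj (v i j) * inner_prod n x (v i))"
    by (simp add: inner_prod_diff_right inner_prod_sum_right inner_prod_scale_right)
  also have "inner_prod n x (\<lambda>m. if m = j then 1 else 0) = cnj (x j)"
    using assms by (simp add: inner_prod_def if_distrib cong: if_cong)
  finally show ?thesis .
qed

lemma inner_prod_orthonormal_residual: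
  assumes "orthonormal n k v" "j < n" "l < k"
  shows "inner_prod n (v l) (residual n k v j) = 0"
proof -
  have "(\<Sum>i<k. cnj (v i j) * inner_prod n (v l) (v i)) = (\<Sum>i<k. if l = i then cnj (v i j) else 0)"
    using assms by (intro sum.cong) (auto simp: orthonormal_def)
  thus ?thesis using assms by (simp add: inner_prod_residual)
qed

lemma norm_sq_residual:
  assumes "orthonormal n k v" "j < n"
  shows "norm_sq n (residual n k v j) = 1 - (\<Sum>i<k. (cmod (v i j))\<^sup>2)"
proof -
  let ?r = "residual n k v j"
  have "inner_prod n ?r (v i) = 0" if "i < k" for i
    using inner_prod_orthonormal_residual[OF assms that] inner_prod_cnj[of n "v i" ?r] by simp
  hence "inner_prod n ?r ?r = cnj (?r j)"
    using assms(2) by (simp add: inner_prod_residual)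
  also have "cnj (?r j) = 1 - (\<Sum>i<k. v i j * cnj (v i j))"
    using assms(2) by (simp add: residual_def)
  also have "\<dots> = complex_of_real (1 - (\<Sum>i<k. (cmod (v i j))\<^sup>2))"
    by (simp only: of_real_diff of_real_sum of_real_1 complex_norm_square)
  finally show ?thesis unfolding inner_prod_self of_real_eq_iff .
qed

text \<open>The sum is the trace of the projection onto the orthogonal complement. It stands in for
  all dimension counting: positivity for \<open>k < n\<close> supplies a vector for continuing the
  system, \<open>k = n\<close> gives completeness, and \<open>k = 1\<close> produces the factor
  \<open>d - 1\<close> of the final constant.\<close>

lemma sum_norm_sq_residual:
  assumes "orthonormal n k v"
  shows "(\<Sum>j<n. norm_sq n (residual n k v j)) = real n - real k"
proof -
  have nrm: "norm_sq n (v i) = 1" if "i < k" for i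
    using assms that inner_prod_self[of n "v i"] unfolding orthonormal_def by simp
  have "(\<Sum>j<n. norm_sq n (residual n k v j)) = real n - (\<Sum>j<n. \<Sum>i<k. (cmod (v i j))\<^sup>2)"
    using assms by (simp add: norm_sq_residual sum_subtractf)
  also have "(\<Sum>j<n. \<Sum>i<k. (cmod (v i j))\<^sup>2) = (\<Sum>i<k. norm_sq n (v i))"
    unfolding norm_sq_def by (rule sum.swap)
  also have "\<dots> = real k" using nrm by simp
  finally show ?thesis .
qed

lemma orthonormal_complete:
  assumes "orthonormal n n v" "j < n" "m < n"
  shows "(\<Sum>i<n. cnj (v i j) * v i m) = (if m = j then 1 else 0)"
proof -
  have "(\<Sum>j<n. norm_sq n (residual n n v j)) = 0"
    using sum_norm_sq_residual[OF assms(1)] by simp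
  hence "norm_sq n (residual n n v j) = 0"
    using assms(2) by (subst (asm) sum_nonneg_eq_0_iff) auto
  hence "residual n n v j m = 0" using assms(3) by (simp add: norm_sq_eq_0_iff)
  thus ?thesis using assms(3) by (simp add: residual_def)
qed

text \<open>Induction on \<open>k\<close>: the next eigenvector maximises the quadratic form on the
  orthogonal complement of those already found, which is nonzero because some residual is.\<close>

lemma hermitian_eigenvectors:
  assumes A: "herm n A" and "k \<le> n"
  shows "\<exists>v. \<exists>l::nat \<Rightarrow> real. orthonormal n k v \<and>
    (\<forall>i<k. apply_op n A (v i) = (\<lambda>j. complex_of_real (l i) * v i j))"
  using \<open>k \<le> n\<close>
proof (induction k)
  case 0
  show ?case by (simp add: orthonormal_def)
next
  case (Suc k)
  then obtain v l where on: "orthonormal n k v"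
    and ev: "\<And>i. i < k \<Longrightarrow> apply_op n A (v i) = (\<lambda>j. complex_of_real (l i) * v i j)"
    by auto
  define S where "S = {x. (\<forall>i\<in>{n..}. x i = 0) \<and> (\<forall>i\<in>{..<k}. inner_prod n (v i) x = 0)}"
  have cl: "closed S"
  proof -
    have "S = (\<Inter>i\<in>{n..}. {x. x i = 0}) \<inter> (\<Inter>i\<in>{..<k}. {x. inner_prod n (v i) x = 0})"
      by (auto simp: S_def)
    moreover have "closed {x::nat \<Rightarrow> complex. x i = 0}" for i
      by (intro closed_Collect_eq continuous_on_coordinate continuous_on_const)
    moreover have "closed {x. inner_prod n (v i) x = 0}" for i
      by (intro closed_Collect_eq continuous_on_inner_prod_right continuous_on_const)
    ultimately show ?thesis by (simp add: closed_INT closed_Int)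
  qed
  have S: "closed_subspace n S"
    unfolding closed_subspace_def using cl
    by (simp add: S_def inner_prod_add_right inner_prod_scale_right)
  obtain j where j: "j < n" "norm_sq n (residual n k v j) \<noteq> 0"
  proof -
    have "(\<Sum>j<n. norm_sq n (residual n k v j)) \<noteq> 0"
      using sum_norm_sq_residual[OF on] Suc.prems by simp
    then obtain j where "j \<in> {..<n}" "norm_sq n (residual n k v j) \<noteq> 0"
      by (rule sum.not_neutral_contains_not_neutral)
    thus thesis using that by auto
  qed
  have "residual n k v j \<in> S"
    using j(1) inner_prod_orthonormal_residual[OF on j(1)] by (simp add: S_def residual_def)
  from compression_top_eigenvector[OF A S this j(2)]
  obtain \<mu> \<psi> where \<psi>: "\<psi> \<in> S" "norm_sq n \<psi> = 1"
    and crit: "\<And>\<phi>. \<phi> \<in> S \<Longrightarrow> inner_prod n \<phi> (apply_op n A \<psi>) = complex_of_real \<mu> * inner_prod n \<phi> \<psi>"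
    by blast
  \<comment> \<open>The critical equation holds only against elements of \<open>S\<close>. The
    complement of eigenvectors is invariant under \<open>A\<close>, so the discrepancy
    \<open>w\<close> lies in \<open>S\<close> and can be tested against itself.\<close>
  define w where "w = (\<lambda>i. apply_op n A \<psi> i - complex_of_real \<mu> * \<psi> i)"
  have orth: "inner_prod n (v i) \<psi> = 0" if "i < k" for i using \<psi>(1) that by (simp add: S_def)
  have "inner_prod n (v i) (apply_op n A \<psi>) = 0" if "i < k" for i
    using orth[OF that] unfolding herm_inner[OF A, symmetric] ev[OF that] inner_prod_scale_left by simp
  hence "inner_prod n (v i) w = 0" if "i < k" for i
    using orth that by (simp add: w_def inner_prod_diff_right inner_prod_scale_right)
  moreover have "w i = 0" if "n \<le> i" for i
    using \<psi>(1) that by (simp add: w_def apply_op_def S_def)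
  ultimately have "w \<in> S" by (simp add: S_def)
  have "inner_prod n w w = inner_prod n w (\<lambda>i. apply_op n A \<psi> i - complex_of_real \<mu> * \<psi> i)"
    by (simp only: w_def)
  also have "\<dots> = 0"
    using crit[OF \<open>w \<in> S\<close>] by (simp add: inner_prod_diff_right inner_prod_scale_right)
  finally have "norm_sq n w = 0" by (simp add: inner_prod_self)
  hence "w i = 0" for i using \<open>w \<in> S\<close> by (cases "i < n") (auto simp: norm_sq_eq_0_iff S_def)
  hence ev\<psi>: "apply_op n A \<psi> = (\<lambda>j. complex_of_real \<mu> * \<psi> j)" by (simp add: w_def fun_eq_iff)
  have orth': "inner_prod n \<psi> (v i) = 0" if "i < k" for i
    using orth[OF that] inner_prod_cnj[of n "v i" \<psi>] by simp
  have "orthonormal n (Suc k) (v(k := \<psi>))"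
    using on \<psi>(2) orth orth' by (simp add: orthonormal_def less_Suc_eq inner_prod_self)
  moreover have "\<forall>i<Suc k. apply_op n A ((v(k := \<psi>)) i) =
      (\<lambda>j. complex_of_real ((l(k := \<mu>)) i) * (v(k := \<psi>)) i j)"
    using ev ev\<psi> by (auto simp: less_Suc_eq)
  ultimately show ?case by blast
qed

lemma hermitian_spectral_decomposition:
  assumes A: "herm n A"
  obtains v and l :: "nat \<Rightarrow> real" where "orthonormal n n v"
    "\<And>i. i < n \<Longrightarrow> apply_op n A (v i) = (\<lambda>j. complex_of_real (l i) * v i j)"
    "\<And>a b. a < n \<Longrightarrow> b < n \<Longrightarrow> A a b = (\<Sum>i<n. complex_of_real (l i) * v i a * cnj (v i b))"
proof -
  obtain v l where v: "orthonormal n n v"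
    and ev: "\<And>i. i < n \<Longrightarrow> apply_op n A (v i) = (\<lambda>j. complex_of_real (l i) * v i j)"
    using hermitian_eigenvectors[OF A order_refl] by blast
  have "A a b = (\<Sum>i<n. complex_of_real (l i) * v i a * cnj (v i b))" if ab: "a < n" "b < n" for a b
  proof -
    have "(\<Sum>i<n. complex_of_real (l i) * v i a * cnj (v i b)) = (\<Sum>i<n. apply_op n A (v i) a * cnj (v i b))"
      by (rule sum.cong) (simp_all add: ev)
    also have "\<dots> = (\<Sum>i<n. \<Sum>m<n. A a m * (cnj (v i b) * v i m))"
    proof (intro sum.cong refl)
      fix i
      have "apply_op n A (v i) a * cnj (v i b) = (\<Sum>m<n. A a m * v i m) * cnj (v i b)"
        using ab by (simp add: apply_op_def)
      also have "\<dots> = (\<Sum>m<n. A a m * (cnj (v i b) * v i m))"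
        unfolding sum_distrib_right by (simp add: mult_ac)
      finally show "apply_op n A (v i) a * cnj (v i b) = (\<Sum>m<n. A a m * (cnj (v i b) * v i m))" .
    qed
    also have "\<dots> = (\<Sum>m<n. A a m * (\<Sum>i<n. cnj (v i b) * v i m))"
      unfolding sum_distrib_left by (rule sum.swap)
    also have "\<dots> = (\<Sum>m<n. if m = b then A a m else 0)"
      using orthonormal_complete[OF v ab(2)] by (intro sum.cong) auto
    also have "\<dots> = A a b" using ab by simp
    finally show ?thesis by simp
  qed
  thus thesis using that v ev by blast
qed

section \<open>The trace norm of a Hermitian matrix\<close>

lemma herm_mat_adjoint:
  assumes "M \<in> carrier_mat n n" "mat_adjoint M = M"
  shows "herm n (\<lambda>i j. M $$ (i, j))"
proof -
  have "mat_adjoint M $$ (i, j) = cnj (M $$ (j, i))" if "i < n" "j < n" for i j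
    using assms(1) that by (simp add: mat_adjoint_def mat_of_rows_def)
  hence "M $$ (i, j) = cnj (M $$ (j, i))" if "i < n" "j < n" for i j
    using that unfolding assms(2) by blast
  thus ?thesis unfolding herm_def by blast
qed

text \<open>With the eigenvectors as columns of \<open>V\<close> and \<open>W\<close> its inverse,
  \<open>M = V D W\<close>, so \<open>M * M\<close> is similar to the diagonal matrix of the squares
  of the \<open>l i\<close>. Its characteristic polynomial then exhibits them with multiplicity, and
  the square roots are absolute values.\<close>

lemma trace_norm_hermitian:
  assumes M: "M \<in> carrier_mat n n" "mat_adjoint M = M"
    and v: "orthonormal n n v"
    and dec: "\<And>a b. a < n \<Longrightarrow> b < n \<Longrightarrow>
      M $$ (a, b) = (\<Sum>i<n. complex_of_real (l i) * v i a * cnj (v i b))"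
  shows "trace_norm M = (\<Sum>i<n. \<bar>l i\<bar>)"
proof -
  define V where "V = mat n n (\<lambda>(i, j). v j i)"
  define W where "W = mat n n (\<lambda>(i, j). cnj (v i j))"
  define D where "D = mat n n (\<lambda>(i, j). if i = j then complex_of_real (l i) else 0)"
  define D2 where "D2 = mat n n (\<lambda>(i, j). if i = j then complex_of_real ((l i)\<^sup>2) else 0)"
  have carr: "V \<in> carrier_mat n n" "W \<in> carrier_mat n n" "D \<in> carrier_mat n n" "D2 \<in> carrier_mat n n"
    by (auto simp: V_def W_def D_def D2_def)
  have "(\<Sum>i<n. v i a * cnj (v i b)) = (if a = b then 1 else 0)" if "a < n" "b < n" for a b
    using orthonormal_complete[OF v that(2,1)] by (simp only: mult.commute)
  hence VW: "V * W = 1\<^sub>m n"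
    by (intro eq_matI) (auto simp: V_def W_def scalar_prod_def simp flip: lessThan_atLeast0)
  have WV: "W * V = 1\<^sub>m n"
    using v by (intro eq_matI)
      (auto simp: V_def W_def scalar_prod_def orthonormal_def inner_prod_def simp flip: lessThan_atLeast0)
  have VD: "V * D = mat n n (\<lambda>(i, j). complex_of_real (l j) * v j i)"
    by (rule eq_matI) (auto simp: V_def D_def scalar_prod_def if_distrib mult.commute cong: if_cong)
  have MVDW: "M = V * D * W"
    unfolding VD using M by (intro eq_matI)
      (auto simp: W_def scalar_prod_def dec simp flip: lessThan_atLeast0)
  have DD: "D * D = D2"
    by (rule eq_matI) (auto simp: D_def D2_def scalar_prod_def if_distrib power2_eq_square cong: if_cong)
  have "M * M = V * D * (W * V) * D * W"
    using carr unfolding MVDW by (simp add: assoc_mult_mat[of _ n n _ n _ n])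
  also have "\<dots> = V * D2 * W"
    using carr unfolding WV DD[symmetric] by (simp add: assoc_mult_mat[of _ n n _ n _ n])
  finally have "similar_mat (M * M) D2"
    using carr VW WV M by (intro similar_matI[of _ _ V W n]) auto
  hence "char_poly (M * M) = char_poly D2" by (rule char_poly_similar)
  also have "\<dots> = (\<Prod>a\<leftarrow>diag_mat D2. [:- a, 1:])"
    using carr by (intro char_poly_upper_triangular[of _ n]) (auto simp: D2_def)
  also have "diag_mat D2 = map (\<lambda>i. complex_of_real ((l i)\<^sup>2)) [0..<n]"
    by (auto simp: diag_mat_def D2_def)
  also have "(\<Prod>a\<leftarrow>\<dots>. [:- a, 1:]) = (\<Prod>i<n. [:- complex_of_real ((l i)\<^sup>2), 1:])"
    by (simp add: comp_def prod.distinct_set_conv_list[symmetric] lessThan_atLeast0)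
  finally have "proots (char_poly (mat_adjoint M * M)) = (\<Sum>i<n. {#complex_of_real ((l i)\<^sup>2)#})"
    using M(2) by (simp add: proots_prod)
  also have "\<dots> = image_mset (\<lambda>i. complex_of_real ((l i)\<^sup>2)) (mset_set {..<n})"
    by (induction n) (simp_all add: lessThan_Suc)
  finally show ?thesis
    unfolding trace_norm_def by (simp add: sum_unfold_sum_mset image_mset.compositionality comp_def)
qed

section \<open>Symmetric tensors\<close>

lemma basis_index_Suc: "basis_index d (Suc N) f = basis_index d N f * d + f N"
proof -
  have "(\<Sum>k<N. f k * d ^ (N - k)) = (\<Sum>k<N. f k * d ^ (N - 1 - k) * d)"
  proof (intro sum.cong refl)
    fix k assume "k \<in> {..<N}"
    hence "N - k = Suc (N - 1 - k)" by auto
    thus "f k * d ^ (N - k) = f k * d ^ (N - 1 - k) * d" by simp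
  qed
  thus ?thesis by (simp add: basis_index_def sum_distrib_right)
qed

lemma basis_index_cong: "(\<And>k. k < N \<Longrightarrow> f k = g k) \<Longrightarrow> basis_index d N f = basis_index d N g"
  by (simp add: basis_index_def)

lemma basis_index_less: "(\<And>k. k < N \<Longrightarrow> f k < d) \<Longrightarrow> basis_index d N f < d ^ N"
proof (induction N)
  case 0
  show ?case by (simp add: basis_index_def)
next
  case (Suc N)
  hence "basis_index d N f < d ^ N" "f N < d" by simp_all
  hence "basis_index d N f * d + f N < basis_index d N f * d + d"
    and "(basis_index d N f + 1) * d \<le> d ^ N * d"
    by (simp, intro mult_right_mono) simp_all
  thus ?case by (simp add: basis_index_Suc algebra_simps)
qed

lemma site_Suc: "k < N \<Longrightarrow> site d (Suc N) i k = site d N (i div d) k"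
proof -
  assume "k < N"
  hence "N - k = Suc (N - 1 - k)" by simp
  thus ?thesis by (simp add: site_def div_mult2_eq)
qed

lemma site_last: "site d (Suc N) i N = i mod d"
  by (simp add: site_def)

lemma site_less: "0 < d \<Longrightarrow> site d N i k < d"
  by (simp add: site_def)

text \<open>Besides base \<open>d\<close>, this is used in base \<open>N + 1\<close> to read
  occupation numbers off an exponent.\<close>

lemma site_basis_index:
  "(\<And>k. k < N \<Longrightarrow> f k < d) \<Longrightarrow> k < N \<Longrightarrow> site d N (basis_index d N f) k = f k"
proof (induction N)
  case (Suc N)
  have "f N < d" using Suc.prems(1) by simp
  show ?case
  proof (cases "k = N")
    case True
    thus ?thesis using \<open>f N < d\<close> by (simp add: basis_index_Suc site_last)
  next
    case False
    hence "k < N" using Suc.prems(2) by simp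
    moreover have "(basis_index d N f * d + f N) div d = basis_index d N f"
      using \<open>f N < d\<close> by simp
    ultimately show ?thesis
      using Suc by (simp add: basis_index_Suc site_Suc)
  qed
qed simp

lemma basis_index_site: "i < d ^ N \<Longrightarrow> basis_index d N (site d N i) = i"
proof (induction N arbitrary: i)
  case 0
  thus ?case by (simp add: basis_index_def)
next
  case (Suc N)
  hence "i div d < d ^ N" by (simp add: less_mult_imp_div_less mult.commute)
  moreover have "basis_index d N (site d (Suc N) i) = basis_index d N (site d N (i div d))"
    by (rule basis_index_cong) (simp add: site_Suc)
  ultimately show ?case using Suc.IH[of "i div d"] by (simp add: basis_index_Suc site_last)
qed

lemma sum_block: "(\<Sum>i<a * b. f i) = (\<Sum>x<a. \<Sum>y<b. f (x * b + y))" for a b :: nat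
proof (induction a)
  case (Suc a)
  have "{..<Suc a * b} = {..<a * b} \<union> {a * b..<a * b + b}" by auto
  hence "(\<Sum>i<Suc a * b. f i) = (\<Sum>i<a * b. f i) + (\<Sum>i=a * b..<a * b + b. f i)"
    by (simp add: sum.union_disjoint ivl_disj_int)
  also have "(\<Sum>i=a * b..<a * b + b. f i) = (\<Sum>y<b. f (a * b + y))"
    using sum.shift_bounds_nat_ivl[of f 0 "a * b" b] by (simp add: lessThan_atLeast0 add.commute)
  finally show ?case using Suc by simp
qed simp

section \<open>Permutations of the sites acting on indices and tensors\<close>

definition permuted_index :: "nat \<Rightarrow> nat \<Rightarrow> (nat \<Rightarrow> nat) \<Rightarrow> nat \<Rightarrow> nat" where
  "permuted_index d N \<pi> i = basis_index d N (\<lambda>k. site d N i (\<pi> k))"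

lemma site_permuted_index:
  assumes "0 < d" "k < N"
  shows "site d N (permuted_index d N \<pi> i) k = site d N i (\<pi> k)"
  unfolding permuted_index_def using assms by (subst site_basis_index) (auto simp: site_less)

lemma bij_betw_permuted_index:
  assumes "0 < d" "\<pi> permutes {..<N}"
  shows "bij_betw (permuted_index d N \<pi>) {..<d ^ N} {..<d ^ N}"
proof (rule bij_betw_byWitness[where f' = "permuted_index d N (inv_into UNIV \<pi>)"])
  have lt: "permuted_index d N \<sigma> i < d ^ N" for \<sigma> i
    unfolding permuted_index_def using assms by (intro basis_index_less) (simp add: site_less)
  \<comment> \<open>The action on indices is contravariant: applying \<open>\<tau>\<close> and then
    \<open>\<sigma>\<close> pulls sites back along \<open>\<tau> \<circ> \<sigma>\<close>.\<close>
  have inv: "permuted_index d N \<sigma> (permuted_index d N \<tau> i) = i"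
    if "\<tau> \<circ> \<sigma> = id" "\<sigma> permutes {..<N}" "i < d ^ N" for \<sigma> \<tau> i
  proof -
    have "permuted_index d N \<sigma> (permuted_index d N \<tau> i) = basis_index d N (site d N i)"
      unfolding permuted_index_def[of d N \<sigma>]
    proof (rule basis_index_cong)
      fix k assume "k < N"
      hence "\<sigma> k < N" using permutes_in_image[OF that(2), of k] by simp
      thus "site d N (permuted_index d N \<tau> i) (\<sigma> k) = site d N i k"
        using fun_cong[OF that(1), of k] assms(1) by (simp add: site_permuted_index)
    qed
    thus ?thesis using basis_index_site[OF that(3)] by simp
  qed
  show "\<forall>i\<in>{..<d ^ N}. permuted_index d N (inv_into UNIV \<pi>) (permuted_index d N \<pi> i) = i"
    using inv[of \<pi> "inv_into UNIV \<pi>"] permutes_inv[OF assms(2)] permutes_inv_o(1)[OF assms(2)] by simp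
  show "\<forall>i\<in>{..<d ^ N}. permuted_index d N \<pi> (permuted_index d N (inv_into UNIV \<pi>) i) = i"
    using inv[of "inv_into UNIV \<pi>" \<pi>] assms(2) permutes_inv_o(2)[OF assms(2)] by simp
  show "permuted_index d N \<pi> ` {..<d ^ N} \<subseteq> {..<d ^ N}"
    "permuted_index d N (inv_into UNIV \<pi>) ` {..<d ^ N} \<subseteq> {..<d ^ N}"
    using lt by auto
qed

definition symmetric :: "nat \<Rightarrow> nat \<Rightarrow> (nat \<Rightarrow> complex) \<Rightarrow> bool" where
  "symmetric d N \<psi> \<longleftrightarrow> (\<forall>\<pi>. \<pi> permutes {..<N} \<longrightarrow> (\<forall>i<d ^ N. \<psi> (permuted_index d N \<pi> i) = \<psi> i))"

definition product_vec :: "nat \<Rightarrow> nat \<Rightarrow> (nat \<Rightarrow> nat \<Rightarrow> complex) \<Rightarrow> nat \<Rightarrow> complex" where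
  "product_vec d N w i = (\<Prod>k<N. w k (site d N i k))"

lemma product_vec_permuted_index:
  assumes "0 < d" "\<pi> permutes {..<N}"
  shows "product_vec d N (w \<circ> \<pi>) (permuted_index d N \<pi> i) = product_vec d N w i"
proof -
  have "product_vec d N (w \<circ> \<pi>) (permuted_index d N \<pi> i) = (\<Prod>k<N. w (\<pi> k) (site d N i (\<pi> k)))"
    unfolding product_vec_def using assms(1) by (intro prod.cong) (simp_all add: site_permuted_index)
  also have "\<dots> = (\<Prod>k<N. w k (site d N i k))"
    using permutes_imp_bij[OF assms(2)] by (rule prod.reindex_bij_betw)
  finally show ?thesis by (simp add: product_vec_def)
qed

text \<open>The index permutation is a change of summation variable that undoes the permutation of
  the factors and leaves \<open>\<psi>\<close> fixed. Overlaps with product vectors therefore depend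
  only on the multiset of factors.\<close>

lemma inner_prod_product_vec_permute:
  assumes "0 < d" "symmetric d N \<psi>" "\<pi> permutes {..<N}"
  shows "inner_prod (d ^ N) (product_vec d N (w \<circ> \<pi>)) \<psi> = inner_prod (d ^ N) (product_vec d N w) \<psi>"
proof -
  have "inner_prod (d ^ N) (product_vec d N (w \<circ> \<pi>)) \<psi>
    = (\<Sum>i<d ^ N. cnj (product_vec d N (w \<circ> \<pi>) (permuted_index d N \<pi> i)) * \<psi> (permuted_index d N \<pi> i))"
    unfolding inner_prod_def
    by (rule sum.reindex_bij_betw[OF bij_betw_permuted_index[OF assms(1,3)], symmetric])
  also have "\<dots> = inner_prod (d ^ N) (product_vec d N w) \<psi>"
    unfolding inner_prod_def
  proof (intro sum.cong refl)
    fix i assume "i \<in> {..<d ^ N}"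
    hence "\<psi> (permuted_index d N \<pi> i) = \<psi> i"
      using assms(2,3) by (simp add: symmetric_def)
    thus "cnj (product_vec d N (w \<circ> \<pi>) (permuted_index d N \<pi> i)) * \<psi> (permuted_index d N \<pi> i)
        = cnj (product_vec d N w i) * \<psi> i"
      by (simp only: product_vec_permuted_index[OF assms(1,3)])
  qed
  finally show ?thesis .
qed

text \<open>A bijection from \<open>S\<close> onto the initial segment is glued to one between the
  complements. This moves any chosen set of sites to the front, so only its cardinality matters for
  a symmetric tensor.\<close>

lemma ex_permutes_initial_segment:
  assumes "S \<subseteq> {..<N}"
  shows "\<exists>\<pi>. \<pi> permutes {..<N} \<and> (\<forall>k<N. \<pi> k < card S \<longleftrightarrow> k \<in> S)"
proof -
  let ?m = "card S"
  have fin: "finite S" and le: "?m \<le> N"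
    using assms finite_subset[OF assms] card_mono[OF _ assms] by auto
  obtain f where f: "bij_betw f S {..<?m}"
    using finite_same_card_bij[OF fin, of "{..<?m}"] by auto
  have "card ({..<N} - S) = card {?m..<N}"
    using assms fin by (simp add: card_Diff_subset)
  then obtain g where g: "bij_betw g ({..<N} - S) {?m..<N}"
    using finite_same_card_bij[of "{..<N} - S" "{?m..<N}"] by auto
  define \<pi> where "\<pi> = (\<lambda>k. if k \<in> {..<N} then (if k \<in> S then f k else g k) else k)"
  have "bij_betw (\<lambda>k. if k \<in> S then f k else g k) (S \<union> ({..<N} - S)) ({..<?m} \<union> {?m..<N})"
    by (rule bij_betw_disjoint_Un[OF f g]) auto
  also have "S \<union> ({..<N} - S) = {..<N}" using assms by auto
  also have "{..<?m} \<union> {?m..<N} = {..<N}" using le by auto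
  finally have "bij_betw \<pi> {..<N} {..<N}"
    by (rule bij_betw_cong[THEN iffD1, rotated]) (simp add: \<pi>_def)
  hence "\<pi> permutes {..<N}" by (rule bij_imp_permutes) (simp add: \<pi>_def)
  moreover have "\<pi> k < ?m \<longleftrightarrow> k \<in> S" if "k < N" for k
    using that bij_betwE[OF f] bij_betwE[OF g] by (auto simp: \<pi>_def not_less)
  ultimately show ?thesis by blast
qed

text \<open>For symmetric \<open>\<psi>\<close> the position of the factors \<open>v\<close> is
  immaterial, so the first \<open>m\<close> sites represent all \<open>N choose m\<close>
  choices.\<close>

definition mixed_form :: "nat \<Rightarrow> nat \<Rightarrow> (nat \<Rightarrow> complex) \<Rightarrow> (nat \<Rightarrow> complex) \<Rightarrow> (nat \<Rightarrow> complex) \<Rightarrow> nat \<Rightarrow> complex" where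
  "mixed_form d N \<psi> u v m = inner_prod (d ^ N) (product_vec d N (\<lambda>k. if k < m then v else u)) \<psi>"

lemma inner_prod_product_vec_cong:
  "(\<And>k. k < N \<Longrightarrow> w k = w' k) \<Longrightarrow> inner_prod n (product_vec d N w) \<psi> = inner_prod n (product_vec d N w') \<psi>"
  by (simp add: product_vec_def inner_prod_def)

lemma sum_Pow_card: "finite A \<Longrightarrow> (\<Sum>S\<in>Pow A. f (card S)) = (\<Sum>m\<le>card A. of_nat (card A choose m) * (f m :: complex))"
proof -
  assume A: "finite A"
  have "(\<Sum>S\<in>Pow A. f (card S)) = (\<Sum>m\<le>card A. \<Sum>S | S \<in> Pow A \<and> card S = m. f (card S))"
    using A by (intro sum.group[symmetric]) (auto intro: card_mono)
  also have "\<dots> = (\<Sum>m\<le>card A. of_nat (card A choose m) * f m)"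
    using A by (intro sum.cong) (simp_all add: n_subsets)
  finally show ?thesis .
qed

text \<open>The product over the sites is expanded over the set \<open>S\<close> of sites that
  receive \<open>t * v\<close>. By symmetry all \<open>S\<close> of equal size contribute equally,
  whence the binomial coefficients; \<open>t\<close> appears conjugated because the product vector
  stands in the antilinear argument.\<close>

lemma tensor_power_line_expansion:
  assumes "0 < d" "symmetric d N \<psi>"
  shows "inner_prod (d ^ N) (product_vec d N (\<lambda>k i. u i + t * v i)) \<psi>
    = (\<Sum>m\<le>N. of_nat (N choose m) * (cnj t ^ m * mixed_form d N \<psi> u v m))"
proof -
  have "product_vec d N (\<lambda>k i. u i + t * v i) i
    = (\<Sum>S\<in>Pow {..<N}. t ^ card S * product_vec d N (\<lambda>k. if k \<in> S then v else u) i)" for i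
  proof -
    have "product_vec d N (\<lambda>k i. u i + t * v i) i = (\<Prod>k<N. t * v (site d N i k) + u (site d N i k))"
      by (simp add: product_vec_def add.commute)
    also have "\<dots> = (\<Sum>S\<in>Pow {..<N}. (\<Prod>k\<in>S. t * v (site d N i k)) * (\<Prod>k\<in>{..<N} - S. u (site d N i k)))"
      by (rule prod_add) simp
    also have "\<dots> = (\<Sum>S\<in>Pow {..<N}. t ^ card S * product_vec d N (\<lambda>k. if k \<in> S then v else u) i)"
    proof (rule sum.cong[OF refl])
      fix S assume "S \<in> Pow {..<N}"
      hence S: "S \<subseteq> {..<N}" "{..<N} \<inter> S = S" by auto
      have "product_vec d N (\<lambda>k. if k \<in> S then v else u) i
        = (\<Prod>k<N. if k \<in> S then v (site d N i k) else u (site d N i k))"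
        unfolding product_vec_def by (rule prod.cong) auto
      also have "\<dots> = (\<Prod>k\<in>S. v (site d N i k)) * (\<Prod>k\<in>{..<N} - S. u (site d N i k))"
        using S by (simp add: prod.If_cases Diff_eq)
      finally show "(\<Prod>k\<in>S. t * v (site d N i k)) * (\<Prod>k\<in>{..<N} - S. u (site d N i k))
        = t ^ card S * product_vec d N (\<lambda>k. if k \<in> S then v else u) i"
        by (simp add: prod.distrib)
    qed
    finally show ?thesis .
  qed
  hence "product_vec d N (\<lambda>k i. u i + t * v i)
    = (\<lambda>i. \<Sum>S\<in>Pow {..<N}. t ^ card S * product_vec d N (\<lambda>k. if k \<in> S then v else u) i)" ..
  hence "inner_prod (d ^ N) (product_vec d N (\<lambda>k i. u i + t * v i)) \<psi>
    = (\<Sum>S\<in>Pow {..<N}. cnj t ^ card S * inner_prod (d ^ N) (product_vec d N (\<lambda>k. if k \<in> S then v else u)) \<psi>)"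
    by (simp add: inner_prod_sum_left inner_prod_scale_left)
  also have "\<dots> = (\<Sum>S\<in>Pow {..<N}. cnj t ^ card S * mixed_form d N \<psi> u v (card S))"
  proof (rule sum.cong[OF refl])
    fix S assume "S \<in> Pow {..<N}"
    hence "S \<subseteq> {..<N}" by simp
    then obtain \<pi> where \<pi>: "\<pi> permutes {..<N}" "\<And>k. k < N \<Longrightarrow> \<pi> k < card S \<longleftrightarrow> k \<in> S"
      using ex_permutes_initial_segment by blast
    let ?w = "\<lambda>k. if k < card S then v else u"
    have "inner_prod (d ^ N) (product_vec d N (\<lambda>k. if k \<in> S then v else u)) \<psi>
      = inner_prod (d ^ N) (product_vec d N (?w \<circ> \<pi>)) \<psi>"
      using \<pi>(2) by (intro inner_prod_product_vec_cong) auto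
    also have "\<dots> = mixed_form d N \<psi> u v (card S)"
      unfolding mixed_form_def using assms \<pi>(1) by (rule inner_prod_product_vec_permute)
    finally show "cnj t ^ card S * inner_prod (d ^ N) (product_vec d N (\<lambda>k. if k \<in> S then v else u)) \<psi>
      = cnj t ^ card S * mixed_form d N \<psi> u v (card S)" by simp
  qed
  also have "\<dots> = (\<Sum>m\<le>N. of_nat (N choose m) * (cnj t ^ m * mixed_form d N \<psi> u v m))"
    using sum_Pow_card[of "{..<N}" "\<lambda>m. cnj t ^ m * mixed_form d N \<psi> u v m"] by simp
  finally show ?thesis .
qed

text \<open>Along the vectors \<open>w\<^sub>x = t ^ (N + 1) ^ (d - 1 - x)\<close> the coefficients of \<open>\<psi>\<close> are separated up to
  permutation of the sites, because the exponents are base-\<open>(N + 1)\<close> encodings of the occupation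
  numbers (Kronecker substitution).\<close>

lemma symmetric_eq_0:
  assumes "0 < d" and sym: "symmetric d N \<psi>"
    and zero: "\<And>w. inner_prod (d ^ N) (product_vec d N (\<lambda>k. w)) \<psi> = 0"
    and "j < d ^ N"
  shows "\<psi> j = 0"
proof -
  define occ where "occ = (\<lambda>i x. card {k \<in> {..<N}. site d N i k = x})"
  define e where "e = (\<lambda>i. basis_index (N + 1) d (occ i))"
  have occ_le: "occ i x < N + 1" for i x
  proof -
    have "card {k \<in> {..<N}. site d N i k = x} \<le> card {..<N}" by (rule card_mono) auto
    thus ?thesis by (simp add: occ_def)
  qed
  have e_sum: "(\<Sum>k<N. (N + 1) ^ (d - 1 - site d N i k)) = e i" for i
  proof -
    have "(\<Sum>k<N. (N + 1) ^ (d - 1 - site d N i k))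
      = (\<Sum>x<d. \<Sum>k | k \<in> {..<N} \<and> site d N i k = x. (N + 1) ^ (d - 1 - site d N i k))"
      using assms(1) by (intro sum.group[symmetric]) (auto simp: site_less)
    also have "\<dots> = e i"
      unfolding e_def basis_index_def occ_def by (intro sum.cong) simp_all
    finally show ?thesis .
  qed
  have "poly (\<Sum>i<d ^ N. monom (\<psi> i) (e i)) t = 0" for t
  proof -
    have "(\<Prod>k<N. t ^ ((N + 1) ^ (d - 1 - site d N i k))) = t ^ e i" for i
      by (simp only: power_sum[symmetric] e_sum)
    \<comment> \<open>The conjugate on \<open>t\<close> in the chosen vector cancels the one in the
      inner product, so that a polynomial in \<open>t\<close> itself arises.\<close>
    hence "cnj (product_vec d N (\<lambda>k x. cnj t ^ ((N + 1) ^ (d - 1 - x))) i) = t ^ e i" for i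
      by (simp add: product_vec_def)
    thus ?thesis
      using zero[of "\<lambda>x. cnj t ^ ((N + 1) ^ (d - 1 - x))"]
      by (simp add: inner_prod_def poly_sum poly_monom mult.commute)
  qed
  hence "(\<Sum>i<d ^ N. monom (\<psi> i) (e i)) = 0" by (simp add: poly_all_0_iff_0[symmetric])
  \<comment> \<open>The coefficient at degree \<open>e j\<close> sums \<open>\<psi>\<close> over all
    indices with the same occupation numbers as \<open>j\<close>. These are permutations of
    \<open>j\<close>, so the sum is a positive multiple of \<open>\<psi> j\<close>.\<close>
  hence "coeff (\<Sum>i<d ^ N. monom (\<psi> i) (e i)) (e j) = 0" by simp
  hence "(\<Sum>i<d ^ N. if e i = e j then \<psi> i else 0) = 0" by (simp add: coeff_sum)
  also have "(\<Sum>i<d ^ N. if e i = e j then \<psi> i else 0) = (\<Sum>i<d ^ N. if e i = e j then \<psi> j else 0)"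
  proof (intro sum.cong refl)
    fix i assume i: "i \<in> {..<d ^ N}"
    show "(if e i = e j then \<psi> i else 0) = (if e i = e j then \<psi> j else 0)"
    proof (cases "e i = e j")
      case True
      have "occ i x = occ j x" if "x < d" for x
        using arg_cong[OF True, of "\<lambda>m. site (N + 1) d m x"] that occ_le
        unfolding e_def by (simp add: site_basis_index)
      moreover have "occ i x = 0" if "\<not> x < d" for i x
        using that site_less[OF assms(1)] by (auto simp: occ_def)
      ultimately have occ: "occ i x = occ j x" for x by (cases "x < d") auto
      have "image_mset (site d N i) (mset_set {..<N}) = image_mset (site d N j) (mset_set {..<N})"
      proof (rule multiset_eqI)
        fix x
        have "count (image_mset (site d N i') (mset_set {..<N})) x = occ i' x" for i'
          by (simp add: count_image_mset' occ_def Collect_conj_eq Int_commute eq_commute)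
        thus "count (image_mset (site d N i) (mset_set {..<N})) x
          = count (image_mset (site d N j) (mset_set {..<N})) x"
          using occ by simp
      qed
      then obtain \<pi> where \<pi>: "\<pi> permutes {..<N}" "\<forall>k\<in>{..<N}. site d N i k = site d N j (\<pi> k)"
        using image_mset_eq_implies_permutes[of "{..<N}"] by blast
      have "permuted_index d N \<pi> j = basis_index d N (site d N i)"
        unfolding permuted_index_def using \<pi>(2) by (intro basis_index_cong) simp
      also have "\<dots> = i" using i by (simp add: basis_index_site)
      finally have "\<psi> i = \<psi> j" using sym \<pi>(1) assms(4) unfolding symmetric_def by metis
      thus ?thesis by simp
    qed simp
  qed
  also have "\<dots> = of_nat (card {i \<in> {..<d ^ N}. e i = e j}) * \<psi> j"
    by (simp add: sum.If_cases Int_def)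
  finally have "card {i \<in> {..<d ^ N}. e i = e j} = 0 \<or> \<psi> j = 0" by simp
  thus ?thesis using assms(4) by auto
qed

section \<open>Overlap with product vectors\<close>

lemma ex_unimodular_mult_eq_norm: "\<exists>\<omega>. cmod \<omega> = 1 \<and> z * \<omega> = complex_of_real (cmod z)"
proof (cases "z = 0")
  case True
  thus ?thesis by (intro exI[of _ 1]) simp
next
  case False
  have "z * (cnj z / cmod z) = (cmod z)\<^sup>2 / cmod z"
    unfolding of_real_divide complex_norm_square by simp
  moreover have "cmod (cnj z / cmod z) = 1" using False by (simp add: norm_divide)
  ultimately show ?thesis using False by (intro exI[of _ "cnj z / cmod z"]) (simp add: power2_eq_square)
qed

lemma nonpos_if_le_all_small:
  fixes a K :: real
  assumes "\<And>r. 0 < r \<Longrightarrow> r \<le> 1 \<Longrightarrow> a \<le> r * K"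
  shows "a \<le> 0"
proof (rule ccontr)
  assume "\<not> a \<le> 0"
  hence a: "a > 0" by simp
  define r where "r = min 1 (a / (2 * (\<bar>K\<bar> + 1)))"
  have r: "0 < r" "r \<le> 1" "r \<le> a / (2 * (\<bar>K\<bar> + 1))" using a by (auto simp: r_def)
  have "r * K \<le> r * (\<bar>K\<bar> + 1)" using r(1) by (intro mult_left_mono) auto
  also have "\<dots> \<le> a / (2 * (\<bar>K\<bar> + 1)) * (\<bar>K\<bar> + 1)" using r(3) by (intro mult_right_mono) auto
  also have "\<dots> = a / 2" by (simp add: field_simps)
  finally show False using assms[OF r(1,2)] a by linarith
qed

text \<open>For small \<open>r = |z|\<close> the right-hand side is \<open>1 + N \<nu> r^2\<close>
  up to higher order, while the left-hand side contains \<open>2 Re (b 1 * z)\<close> and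
  \<open>2 Re (b 2 * z^2)\<close>. The argument of \<open>z\<close> is free, so each real part can
  be turned into a modulus: order \<open>r\<close> forces \<open>b 1 = 0\<close>, and order
  \<open>r^2\<close> then bounds \<open>b 2\<close>.\<close>

lemma dominated_polynomial_coeffs:
  fixes b :: "nat \<Rightarrow> complex" and \<nu> :: real
  assumes "2 \<le> N" "0 \<le> \<nu>" "b 0 = 1"
    and dom: "\<And>z. (cmod (\<Sum>m\<le>N. b m * z ^ m))\<^sup>2 \<le> (1 + \<nu> * (cmod z)\<^sup>2) ^ N"
  shows "b 1 = 0" "2 * cmod (b 2) \<le> real N * \<nu>"
proof -
  define B where "B = (\<Sum>m\<le>N. cmod (b m))"
  \<comment> \<open>\<open>K\<close> collects everything of order \<open>r^3\<close>: the binomial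
    remainder on the right and twice the polynomial tail on the left.\<close>
  define K where "K = (1 + \<nu>) ^ N + 2 * B"
  have split3: "{..N} = {0, 1, 2} \<union> {3..N}" using assms(1) by auto
  have main: "2 * Re (b 1 * \<omega>) * r + 2 * Re (b 2 * \<omega>\<^sup>2) * r\<^sup>2 \<le> real N * \<nu> * r\<^sup>2 + r ^ 3 * K"
    if "cmod \<omega> = 1" "0 < r" "r \<le> 1" for \<omega> and r :: real
  proof -
    define z where "z = r * \<omega>"
    have z: "cmod z = r" using that by (simp add: z_def norm_mult)
    define R where "R = (\<Sum>m=3..N. b m * z ^ m)"
    have "cmod R \<le> (\<Sum>m=3..N. cmod (b m) * r ^ 3)"
      unfolding R_def
    proof (rule sum_norm_le)
      fix m assume "m \<in> {3..N}"
      hence "r ^ m \<le> r ^ 3" using that by (intro power_decreasing) auto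
      thus "cmod (b m * z ^ m) \<le> cmod (b m) * r ^ 3"
        by (simp add: norm_mult norm_power z mult_left_mono)
    qed
    also have "\<dots> \<le> B * r ^ 3"
      unfolding B_def sum_distrib_right using that by (intro sum_mono2) auto
    finally have R: "cmod R \<le> B * r ^ 3" .
    have "(\<Sum>m\<le>N. b m * z ^ m) = 1 + b 1 * z + b 2 * z\<^sup>2 + R"
      unfolding split3 R_def by (subst sum.union_disjoint) (auto simp: assms(3))
    \<comment> \<open>The lower bound \<open>2 Re q - 1\<close> for \<open>|q|^2\<close>, where
      \<open>q\<close> is the value of the polynomial, makes the left-hand side linear in the
      coefficients and avoids all cross terms.\<close>
    hence q: "2 * Re (1 + b 1 * z + b 2 * z\<^sup>2 + R) - 1 \<le> (1 + \<nu> * r\<^sup>2) ^ N"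
    proof -
      let ?q = "1 + b 1 * z + b 2 * z\<^sup>2 + R"
      have "0 \<le> (cmod (?q - 1))\<^sup>2" by simp
      also have "\<dots> = (cmod ?q)\<^sup>2 - 2 * Re ?q + 1"
        unfolding cmod_power2 by (simp add: power2_eq_square algebra_simps)
      finally have "2 * Re ?q - 1 \<le> (cmod ?q)\<^sup>2" by simp
      also have "\<dots> \<le> (1 + \<nu> * r\<^sup>2) ^ N"
        using dom[of z] \<open>(\<Sum>m\<le>N. b m * z ^ m) = ?q\<close> z by simp
      finally show ?thesis .
    qed
    have "(1 + \<nu> * r\<^sup>2) ^ N = (\<Sum>m\<le>N. of_nat (N choose m) * (\<nu> * r\<^sup>2) ^ m)"
      using binomial_ring[of "\<nu> * r\<^sup>2" 1 N] by (simp add: add.commute)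
    \<comment> \<open>Terms with \<open>m \<ge> 2\<close> carry \<open>r^4\<close> or more and are
      absorbed into \<open>r^3\<close> because \<open>r \<le> 1\<close>; for \<open>m < 2\<close>
      the extra summand is a nonnegative surplus.\<close>
    also have "\<dots> \<le> (\<Sum>m\<le>N. (if m = 0 then 1 else if m = 1 then real N * \<nu> * r\<^sup>2 else 0)
        + of_nat (N choose m) * \<nu> ^ m * r ^ 3)"
    proof (rule sum_mono)
      fix m assume "m \<in> {..N}"
      have nn: "0 \<le> real (N choose m) * \<nu> ^ m * r ^ 3" using assms(2) that by simp
      show "real (N choose m) * (\<nu> * r\<^sup>2) ^ m \<le> (if m = 0 then 1 else if m = 1 then real N * \<nu> * r\<^sup>2 else 0)
        + real (N choose m) * \<nu> ^ m * r ^ 3"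
      proof (cases "m < 2")
        case True
        hence "m = 0 \<or> m = 1" by auto
        thus ?thesis using nn by auto
      next
        case False
        have "r ^ (2 * m) \<le> r ^ 3" using that False by (intro power_decreasing) auto
        hence "real (N choose m) * \<nu> ^ m * r ^ (2 * m) \<le> real (N choose m) * \<nu> ^ m * r ^ 3"
          using assms(2) by (intro mult_left_mono) auto
        thus ?thesis using False by (simp add: power_mult_distrib power_mult mult.assoc)
      qed
    qed
    also have "\<dots> = (\<Sum>m\<le>N. if m = 0 then 1 else if m = 1 then real N * \<nu> * r\<^sup>2 else 0)
        + (1 + \<nu>) ^ N * r ^ 3"
      using binomial_ring[of \<nu> 1 N] by (simp add: sum.distrib sum_distrib_right add.commute)
    also have "(\<Sum>m\<le>N. if m = 0 then 1 else if m = 1 then real N * \<nu> * r\<^sup>2 else 0) = 1 + real N * \<nu> * r\<^sup>2"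
      unfolding split3 by (subst sum.union_disjoint) auto
    finally have "2 * Re (b 1 * z + b 2 * z\<^sup>2) \<le> real N * \<nu> * r\<^sup>2 + (1 + \<nu>) ^ N * r ^ 3 - 2 * Re R"
      using q by simp
    moreover have "- Re R \<le> B * r ^ 3" using R abs_Re_le_cmod[of R] by linarith
    ultimately have "2 * Re (b 1 * z + b 2 * z\<^sup>2) \<le> real N * \<nu> * r\<^sup>2 + r ^ 3 * K"
      by (simp add: K_def algebra_simps)
    moreover have "b 1 * z + b 2 * z\<^sup>2 = r * (b 1 * \<omega>) + (r\<^sup>2) *\<^sub>R (b 2 * \<omega>\<^sup>2)"
      by (simp add: z_def power_mult_distrib scaleR_conv_of_real algebra_simps)
    hence "Re (b 1 * z + b 2 * z\<^sup>2) = r * Re (b 1 * \<omega>) + r\<^sup>2 * Re (b 2 * \<omega>\<^sup>2)"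
      by simp
    ultimately show ?thesis by (simp add: algebra_simps)
  qed
  show b1: "b 1 = 0"
  proof -
    obtain \<omega> where \<omega>: "cmod \<omega> = 1" "b 1 * \<omega> = complex_of_real (cmod (b 1))"
      using ex_unimodular_mult_eq_norm by blast
    have "2 * cmod (b 1) \<le> r * (real N * \<nu> + \<bar>K\<bar> + 2 * cmod (b 2))" if "0 < r" "r \<le> 1" for r :: real
    proof -
      have "\<bar>Re (b 2 * \<omega>\<^sup>2)\<bar> \<le> cmod (b 2 * \<omega>\<^sup>2)" by (rule abs_Re_le_cmod)
      also have "\<dots> = cmod (b 2)" using \<omega>(1) by (simp add: norm_mult norm_power)
      finally have "- 2 * Re (b 2 * \<omega>\<^sup>2) * r\<^sup>2 \<le> 2 * cmod (b 2) * r\<^sup>2"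
        by (intro mult_right_mono) auto
      moreover have "r ^ 3 * K \<le> r\<^sup>2 * \<bar>K\<bar>"
      proof -
        have "r ^ 3 * K \<le> r ^ 3 * \<bar>K\<bar>" using that by (intro mult_left_mono) auto
        also have "\<dots> \<le> r\<^sup>2 * \<bar>K\<bar>" using that by (intro mult_right_mono power_decreasing) auto
        finally show ?thesis .
      qed
      moreover have "2 * cmod (b 1) * r + 2 * Re (b 2 * \<omega>\<^sup>2) * r\<^sup>2 \<le> real N * \<nu> * r\<^sup>2 + r ^ 3 * K"
        using main[OF \<omega>(1) that] by (simp only: \<omega>(2) Re_complex_of_real)
      ultimately have "2 * cmod (b 1) * r \<le> real N * \<nu> * r\<^sup>2 + r\<^sup>2 * \<bar>K\<bar> + 2 * cmod (b 2) * r\<^sup>2"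
        by linarith
      hence "2 * cmod (b 1) * r \<le> r\<^sup>2 * (real N * \<nu> + \<bar>K\<bar> + 2 * cmod (b 2))"
        by (simp add: algebra_simps)
      thus ?thesis using that(1) by (simp add: power2_eq_square mult.commute)
    qed
    hence "2 * cmod (b 1) \<le> 0" by (rule nonpos_if_le_all_small)
    thus ?thesis by simp
  qed
  show "2 * cmod (b 2) \<le> real N * \<nu>"
  proof -
    obtain \<omega> where \<omega>: "cmod \<omega> = 1" "b 2 * \<omega> = complex_of_real (cmod (b 2))"
      using ex_unimodular_mult_eq_norm by blast
    \<comment> \<open>A square root of \<open>\<omega>\<close> is taken because the phase of
      \<open>z\<close> enters the second-order term squared.\<close>
    have s: "cmod (csqrt \<omega>) = 1" using \<omega>(1) by simp
    have "2 * cmod (b 2) - real N * \<nu> \<le> r * K" if "0 < r" "r \<le> 1" for r :: real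
    proof -
      have "2 * cmod (b 2) * r\<^sup>2 \<le> real N * \<nu> * r\<^sup>2 + r ^ 3 * K"
        using main[OF s that] b1 \<omega>(2) by simp
      hence "r\<^sup>2 * (2 * cmod (b 2) - real N * \<nu>) \<le> r\<^sup>2 * (r * K)"
        by (simp add: algebra_simps power2_eq_square power3_eq_cube)
      thus ?thesis using that(1) by simp
    qed
    hence "2 * cmod (b 2) - real N * \<nu> \<le> 0" by (rule nonpos_if_le_all_small)
    thus ?thesis by simp
  qed
qed

lemma product_vec_scale: "product_vec d N (\<lambda>k i. s * w k i) = (\<lambda>i. s ^ N * product_vec d N w i)"
  by (simp add: product_vec_def prod.distrib fun_eq_iff)

text \<open>The overlap is homogeneous of degree \<open>N\<close> in \<open>w\<close>, so a bound on
  the unit sphere extends to all vectors. With \<open>c = 0\<close> it shows that all overlaps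
  vanish as soon as those on the sphere do.\<close>

lemma tensor_power_maximum_homogeneous:
  assumes "0 < d" "0 < N"
    and max: "\<And>w. w \<in> unit_sphere d \<Longrightarrow> cmod (inner_prod (d ^ N) (product_vec d N (\<lambda>k. w)) \<psi>) \<le> c"
  shows "(cmod (inner_prod (d ^ N) (product_vec d N (\<lambda>k. w)) \<psi>))\<^sup>2 \<le> c\<^sup>2 * norm_sq d w ^ N"
proof (cases "norm_sq d w = 0")
  case True
  hence "product_vec d N (\<lambda>k. w) i = 0" for i
    using assms(1,2) by (auto simp: product_vec_def norm_sq_eq_0_iff site_less)
  thus ?thesis using True assms(2) by (simp add: inner_prod_def)
next
  case False
  hence pos: "norm_sq d w > 0" using norm_sq_nonneg[of d w] by linarith
  define s where "s = sqrt (norm_sq d w)"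
  have s: "s > 0" "s\<^sup>2 = norm_sq d w" using pos by (auto simp: s_def)
  \<comment> \<open>Truncation beyond \<open>d\<close> is needed for membership in
    \<open>unit_sphere\<close>; product vectors do not notice it, since every site value is below
    \<open>d\<close>.\<close>
  define x where "x = (\<lambda>i. if i < d then complex_of_real (1 / s) * w i else 0)"
  have "norm_sq d x = norm_sq d (\<lambda>i. complex_of_real (1 / s) * w i)"
    by (simp add: norm_sq_def x_def)
  also have "\<dots> = 1" unfolding norm_sq_scale norm_of_real using s False by (simp add: power_divide)
  finally have "x \<in> unit_sphere d" by (simp add: unit_sphere_def x_def)
  have "product_vec d N (\<lambda>k. w) i = complex_of_real s ^ N * product_vec d N (\<lambda>k. x) i" for i
  proof -
    have "product_vec d N (\<lambda>k. w) i = product_vec d N (\<lambda>k i. complex_of_real s * x i) i"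
      unfolding product_vec_def using s(1) assms(1) by (intro prod.cong) (auto simp: x_def site_less)
    thus ?thesis by (simp add: product_vec_scale)
  qed
  hence "product_vec d N (\<lambda>k. w) = (\<lambda>i. complex_of_real s ^ N * product_vec d N (\<lambda>k. x) i)" ..
  hence "cmod (inner_prod (d ^ N) (product_vec d N (\<lambda>k. w)) \<psi>)
    = s ^ N * cmod (inner_prod (d ^ N) (product_vec d N (\<lambda>k. x)) \<psi>)"
    using s(1) by (simp add: inner_prod_scale_left norm_mult norm_power)
  also have "\<dots> \<le> s ^ N * c" using s(1) max[OF \<open>x \<in> unit_sphere d\<close>] by (intro mult_left_mono) auto
  finally have "(cmod (inner_prod (d ^ N) (product_vec d N (\<lambda>k. w)) \<psi>))\<^sup>2 \<le> (s ^ N * c)\<^sup>2"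
    by (intro power_mono) auto
  also have "\<dots> = c\<^sup>2 * norm_sq d w ^ N"
    by (simp add: power_mult_distrib s(2)[symmetric] power_mult[symmetric] mult.commute)
  finally show ?thesis .
qed

lemma norm_sq_add_orthogonal:
  assumes "inner_prod n u v = 0"
  shows "norm_sq n (\<lambda>i. u i + t * v i) = norm_sq n u + (cmod t)\<^sup>2 * norm_sq n v"
proof -
  have "inner_prod n v u = 0" using assms inner_prod_cnj[of n u v] by simp
  hence "complex_of_real (norm_sq n (\<lambda>i. u i + t * v i)) = norm_sq n u + (t * cnj t) * norm_sq n v"
    unfolding inner_prod_self[symmetric] inner_prod_add_left inner_prod_add_right
      inner_prod_scale_left inner_prod_scale_right using assms by simp
  also have "t * cnj t = (cmod t)\<^sup>2" by (rule complex_norm_square[symmetric])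
  finally have "complex_of_real (norm_sq n (\<lambda>i. u i + t * v i)) = complex_of_real (norm_sq n u + (cmod t)\<^sup>2 * norm_sq n v)"
    by simp
  thus ?thesis unfolding of_real_eq_iff .
qed

text \<open>For \<open>v\<close> orthogonal to \<open>u\<close> the squared norm of
  \<open>u + t v\<close> is \<open>1 + |t|^2 |v|^2\<close>, so maximality makes the line expansion,
  divided by \<open>c\<close>, a dominated polynomial. Its second coefficient contains
  \<open>N choose 2\<close>; cancelling \<open>N\<close> from \<open>N (N - 1)\<close> against
  \<open>N |v|^2\<close> leaves the rate \<open>1 / (N - 1)\<close>.\<close>

lemma mixed_form_at_maximum:
  assumes "0 < d" "2 \<le> N" "symmetric d N \<psi>" "u \<in> unit_sphere d"
    and c: "c = inner_prod (d ^ N) (product_vec d N (\<lambda>k. u)) \<psi>" "c \<noteq> 0"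
    and max: "\<And>w. w \<in> unit_sphere d \<Longrightarrow> cmod (inner_prod (d ^ N) (product_vec d N (\<lambda>k. w)) \<psi>) \<le> cmod c"
    and orth: "inner_prod d u v = 0"
  shows "mixed_form d N \<psi> u v 1 = 0"
    "cmod (mixed_form d N \<psi> u v 2) \<le> cmod c * (norm_sq d v / (real N - 1))"
proof -
  define b where "b = (\<lambda>m. of_nat (N choose m) * mixed_form d N \<psi> u v m / c)"
  have "b 0 = 1" using c by (simp add: b_def mixed_form_def)
  have dom: "(cmod (\<Sum>m\<le>N. b m * z ^ m))\<^sup>2 \<le> (1 + norm_sq d v * (cmod z)\<^sup>2) ^ N" for z
  proof -
    have "inner_prod (d ^ N) (product_vec d N (\<lambda>k i. u i + cnj z * v i)) \<psi>
      = (\<Sum>m\<le>N. of_nat (N choose m) * (z ^ m * mixed_form d N \<psi> u v m))"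
      using tensor_power_line_expansion[OF assms(1,3), of u "cnj z" v] by simp
    also have "\<dots> = c * (\<Sum>m\<le>N. b m * z ^ m)"
      using c(2) by (simp add: b_def sum_distrib_left mult_ac)
    finally have "(cmod c)\<^sup>2 * (cmod (\<Sum>m\<le>N. b m * z ^ m))\<^sup>2
      = (cmod (inner_prod (d ^ N) (product_vec d N (\<lambda>k i. u i + cnj z * v i)) \<psi>))\<^sup>2"
      by (simp add: norm_mult power_mult_distrib)
    also have "\<dots> \<le> (cmod c)\<^sup>2 * norm_sq d (\<lambda>i. u i + cnj z * v i) ^ N"
      using assms(1,2) max by (intro tensor_power_maximum_homogeneous) auto
    also have "norm_sq d (\<lambda>i. u i + cnj z * v i) = 1 + norm_sq d v * (cmod z)\<^sup>2"
      using assms(4) norm_sq_add_orthogonal[OF orth, of "cnj z"] by (simp add: unit_sphere_def mult.commute)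
    finally show ?thesis using c(2) by simp
  qed
  note coeffs = dominated_polynomial_coeffs[OF assms(2) norm_sq_nonneg \<open>b 0 = 1\<close> dom]
  show "mixed_form d N \<psi> u v 1 = 0" using coeffs(1) c(2) assms(2) by (simp add: b_def)
  have "2 * real (N choose 2) = real N * (real N - 1)"
  proof -
    have "even (N * (N - 1))" by (cases N) simp_all
    hence "2 * (N choose 2) = N * (N - 1)" unfolding choose_two by (rule dvd_mult_div_cancel)
    hence "real (2 * (N choose 2)) = real (N * (N - 1))" by (simp only:)
    thus ?thesis using assms(2) by (simp add: of_nat_diff)
  qed
  hence "2 * cmod (b 2) = real N * (real N - 1) * cmod (mixed_form d N \<psi> u v 2) / cmod c"
    by (simp add: b_def norm_mult norm_divide)
  hence "real N * ((real N - 1) * cmod (mixed_form d N \<psi> u v 2) / cmod c) \<le> real N * norm_sq d v"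
    using coeffs(2) by (simp add: mult.assoc)
  hence "(real N - 1) * cmod (mixed_form d N \<psi> u v 2) / cmod c \<le> norm_sq d v"
    by (rule mult_left_le_imp_le) (use assms(2) in simp)
  thus "cmod (mixed_form d N \<psi> u v 2) \<le> cmod c * (norm_sq d v / (real N - 1))"
    using c(2) assms(2) by (simp add: field_simps)
qed

section \<open>Contraction to two sites\<close>

text \<open>The pairing of \<open>v \<otimes> w\<close> with a two-site vector \<open>T\<close>.
  Both arguments are conjugated, so for symmetric forms polarization takes two terms, as in the real
  case.\<close>

definition antibilinear :: "nat \<Rightarrow> (nat \<Rightarrow> complex) \<Rightarrow> (nat \<Rightarrow> complex) \<Rightarrow> (nat \<Rightarrow> complex) \<Rightarrow> complex" where
  "antibilinear d T v w = (\<Sum>x<d. \<Sum>y<d. cnj (v x) * cnj (w y) * T (x * d + y))"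

lemma antibilinear_add_left: "antibilinear d T (\<lambda>i. v i + v' i) w = antibilinear d T v w + antibilinear d T v' w"
  by (simp add: antibilinear_def algebra_simps sum.distrib)

lemma antibilinear_add_right: "antibilinear d T v (\<lambda>i. w i + w' i) = antibilinear d T v w + antibilinear d T v w'"
  by (simp add: antibilinear_def algebra_simps sum.distrib)

lemma antibilinear_diff_left: "antibilinear d T (\<lambda>i. v i - v' i) w = antibilinear d T v w - antibilinear d T v' w"
  by (simp add: antibilinear_def algebra_simps sum_subtractf)

lemma antibilinear_diff_right: "antibilinear d T v (\<lambda>i. w i - w' i) = antibilinear d T v w - antibilinear d T v w'"
  by (simp add: antibilinear_def algebra_simps sum_subtractf)

lemma antibilinear_scale_left: "antibilinear d T (\<lambda>i. s * v i) w = cnj s * antibilinear d T v w"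
  by (simp add: antibilinear_def sum_distrib_left mult.assoc)

lemma antibilinear_scale_right: "antibilinear d T v (\<lambda>i. s * w i) = cnj s * antibilinear d T v w"
  by (simp add: antibilinear_def sum_distrib_left mult_ac)

lemma antibilinear_cong: "(\<And>i. i < d \<Longrightarrow> v i = v' i) \<Longrightarrow> antibilinear d T v w = antibilinear d T v' w"
  by (simp add: antibilinear_def)

lemma norm_sq_parallelogram:
  "norm_sq n (\<lambda>i. v i + w i) + norm_sq n (\<lambda>i. v i - w i) = 2 * norm_sq n v + 2 * norm_sq n w"
proof -
  have "(cmod (a + b))\<^sup>2 + (cmod (a - b))\<^sup>2 = 2 * (cmod a)\<^sup>2 + 2 * (cmod b)\<^sup>2" for a b
    unfolding cmod_power2 by (simp add: power2_eq_square algebra_simps)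
  thus ?thesis
    unfolding norm_sq_def sum.distrib[symmetric] sum_distrib_left by (intro sum.cong) auto
qed

text \<open>Four times the form is the difference of its diagonal values at \<open>v + w\<close> and
  \<open>v - w\<close>, and the parallelogram law adds up their bounds with no loss of constant.
  Both vectors stay orthogonal to \<open>u\<close>, where \<open>diag\<close> applies.\<close>

lemma antibilinear_polarization_bound:
  assumes sym: "\<And>v w. antibilinear d T v w = antibilinear d T w v"
    and diag: "\<And>v. inner_prod d u v = 0 \<Longrightarrow> cmod (antibilinear d T v v) \<le> e * norm_sq d v"
    and "inner_prod d u v = 0" "inner_prod d u w = 0"
  shows "2 * cmod (antibilinear d T v w) \<le> e * (norm_sq d v + norm_sq d w)"
proof -
  let ?p = "\<lambda>i. v i + w i" and ?m = "\<lambda>i. v i - w i"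
  have "4 * antibilinear d T v w = antibilinear d T ?p ?p - antibilinear d T ?m ?m"
    unfolding antibilinear_add_left antibilinear_add_right antibilinear_diff_left antibilinear_diff_right
    unfolding sym[of w v] by simp
  hence "cmod (4 * antibilinear d T v w) = cmod (antibilinear d T ?p ?p - antibilinear d T ?m ?m)"
    by (rule arg_cong)
  hence "4 * cmod (antibilinear d T v w) = cmod (antibilinear d T ?p ?p - antibilinear d T ?m ?m)"
    by (simp add: norm_mult)
  also have "\<dots> \<le> cmod (antibilinear d T ?p ?p) + cmod (antibilinear d T ?m ?m)"
    by (rule norm_triangle_ineq4)
  also have "\<dots> \<le> e * norm_sq d ?p + e * norm_sq d ?m"
    using assms(3,4) by (intro add_mono diag) (simp_all add: inner_prod_add_right inner_prod_diff_right)
  also have "\<dots> = e * (2 * norm_sq d v + 2 * norm_sq d w)"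
    unfolding distrib_left[symmetric] norm_sq_parallelogram ..
  finally show ?thesis by (simp add: algebra_simps)
qed

text \<open>On the orthogonal complement of \<open>u\<close> the form \<open>K\<close> has operator norm at most \<open>e\<close>, and this complement
  has dimension \<open>d - 1\<close>.\<close>

lemma antibilinear_frobenius_bound:
  assumes "0 < e" "norm_sq d u = 1"
    and sym: "\<And>v w. antibilinear d K v w = antibilinear d K w v"
    and van: "\<And>w. antibilinear d K u w = 0"
    and diag: "\<And>v. inner_prod d u v = 0 \<Longrightarrow> cmod (antibilinear d K v v) \<le> e * norm_sq d v"
  shows "norm_sq (d ^ 2) K \<le> e\<^sup>2 * (real d - 1)"
proof -
  have on: "orthonormal d 1 (\<lambda>_. u)"
    using assms(2) by (simp add: orthonormal_def inner_prod_self)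
  have row: "norm_sq d (\<lambda>y. K (x * d + y)) \<le> e\<^sup>2 * norm_sq d (residual d 1 (\<lambda>_. u) x)" if x: "x < d" for x
  proof -
    define w where "w = (\<lambda>y. K (x * d + y))"
    \<comment> \<open>The basis vector \<open>\<delta>\<close> picks out row \<open>x\<close> of
      \<open>K\<close>. As \<open>K\<close> annihilates \<open>u\<close>, it may be replaced by its
      residual, and the residuals have total squared norm \<open>d - 1\<close>.\<close>
    define \<delta> where "\<delta> = (\<lambda>i. if i = x then 1 else 0 :: complex)"
    let ?r = "residual d 1 (\<lambda>_. u) x"
    have \<delta>: "antibilinear d K \<delta> v = inner_prod d v w" for v
    proof -
      have "antibilinear d K \<delta> v = (\<Sum>i<d. if i = x then \<Sum>y<d. cnj (v y) * K (i * d + y) else 0)"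
        unfolding antibilinear_def \<delta>_def by (intro sum.cong) auto
      thus ?thesis using x by (simp add: inner_prod_def w_def)
    qed
    have orth: "inner_prod d u w = 0" using \<delta>[of u] sym[of \<delta> u] van by simp
    have orth_r: "inner_prod d u ?r = 0"
      using inner_prod_orthonormal_residual[OF on x, of 0] by simp
    have "antibilinear d K ?r w = antibilinear d K (\<lambda>i. \<delta> i - cnj (u x) * u i) w"
      by (rule antibilinear_cong) (simp add: residual_def \<delta>_def)
    also have "\<dots> = norm_sq d w"
      by (simp add: antibilinear_diff_left antibilinear_scale_left van \<delta> inner_prod_self)
    finally have Kr: "antibilinear d K ?r w = norm_sq d w" .
    \<comment> \<open>With the scaling \<open>1 / e\<close> the term in \<open>norm_sq d w\<close>
      on the right equals half of the left-hand side, and what remains is the row estimate.\<close>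
    let ?w = "\<lambda>i. complex_of_real (1 / e) * w i"
    have "inner_prod d u ?w = 0" by (simp only: inner_prod_scale_right orth mult_zero_right)
    from antibilinear_polarization_bound[of d K u e, OF sym diag orth_r this]
    have "2 * cmod (antibilinear d K ?r ?w) \<le> e * (norm_sq d ?r + norm_sq d ?w)" .
    moreover have "cmod (antibilinear d K ?r ?w) = norm_sq d w / e"
      unfolding antibilinear_scale_right Kr using assms(1) by (simp add: norm_mult norm_divide)
    moreover have "norm_sq d ?w = norm_sq d w / e\<^sup>2"
      unfolding norm_sq_scale norm_of_real by (simp add: power_divide)
    ultimately have "2 * (norm_sq d w / e) \<le> e * norm_sq d ?r + norm_sq d w / e"
      using assms(1) by (simp add: power2_eq_square distrib_left)
    hence "norm_sq d w / e \<le> e * norm_sq d ?r" by simp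
    thus ?thesis using assms(1) by (simp add: w_def pos_divide_le_eq power2_eq_square mult_ac)
  qed
  have "norm_sq (d ^ 2) K = (\<Sum>x<d. norm_sq d (\<lambda>y. K (x * d + y)))"
    unfolding norm_sq_def power2_eq_square[of d] by (rule sum_block)
  also have "\<dots> \<le> (\<Sum>x<d. e\<^sup>2 * norm_sq d (residual d 1 (\<lambda>_. u) x))"
    using row by (intro sum_mono) auto
  also have "\<dots> = e\<^sup>2 * (real d - 1)"
    using sum_norm_sq_residual[OF on] by (simp flip: sum_distrib_left)
  finally show ?thesis .
qed

section \<open>Splitting indices after the first two sites\<close>

lemma block_div: "b \<noteq> 0 \<Longrightarrow> (x * b + y) div b = x + y div b" for x y b :: nat
  by simp

lemma block_div_less: "y < b \<Longrightarrow> (x * b + y) div b = x" for x y b :: nat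
  by simp

lemma block_mod_less: "y < b \<Longrightarrow> (x * b + y) mod b = y" for x y b :: nat
  by simp

lemma block_index_less:
  fixes a c d M :: nat
  assumes "a < d ^ 2" "c < d ^ M"
  shows "a * d ^ M + c < d ^ Suc (Suc M)"
proof -
  have "a * d ^ M + c < (a + 1) * d ^ M" using assms(2) by simp
  also have "\<dots> \<le> d ^ 2 * d ^ M" using assms(1) by (intro mult_right_mono) auto
  finally show ?thesis by (simp add: power2_eq_square mult.assoc)
qed

lemma product_vec_block:
  assumes "a < d ^ 2" "c < d ^ M"
  shows "product_vec d (Suc (Suc M)) w (a * d ^ M + c)
    = w 0 (a div d) * w 1 (a mod d) * product_vec d M (\<lambda>k. w (Suc (Suc k))) c"
proof -
  let ?i = "a * d ^ M + c"
  have q: "?i div d ^ M = a" using assms(2) by (rule block_div_less)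
  have "a div d < d" using assms(1) by (simp add: less_mult_imp_div_less power2_eq_square)
  moreover have "?i div d ^ Suc M = a div d"
    using q by (simp add: mult.commute[of d] div_mult2_eq)
  ultimately have "site d (Suc (Suc M)) ?i 0 = a div d" by (simp add: site_def)
  moreover have "site d (Suc (Suc M)) ?i (Suc 0) = a mod d" using q by (simp add: site_def)
  moreover have "site d (Suc (Suc M)) ?i (Suc (Suc k)) = site d M c k" if "k < M" for k
  proof -
    \<comment> \<open>The offset \<open>a * d ^ M\<close> is a multiple of \<open>d * b\<close>, so
      after division by \<open>b\<close> it vanishes modulo \<open>d\<close>, and only
      \<open>c\<close> determines the digit.\<close>
    define b where "b = d ^ (M - 1 - k)"
    have "M = Suc k + (M - 1 - k)" using that by simp
    hence "d ^ M = d ^ Suc k * b" unfolding b_def by (metis power_add)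
    hence "?i = d * (a * d ^ k) * b + c" by (simp only: power_Suc mult_ac)
    moreover have "b \<noteq> 0" using assms(2) that by (cases "d = 0") (auto simp: b_def zero_power)
    ultimately have "?i div b = d * (a * d ^ k) + c div b" by (metis block_div)
    thus ?thesis by (simp add: site_def b_def)
  qed
  ultimately show ?thesis
    by (simp add: product_vec_def prod.lessThan_Suc_shift mult.assoc del: prod.lessThan_Suc)
qed

text \<open>The number of sites is written \<open>Suc (Suc M)\<close>, so that \<open>M\<close>
  sites are contracted and \<open>N - 1\<close> becomes \<open>M + 1\<close>, without truncated
  subtraction.\<close>

definition contraction :: "nat \<Rightarrow> nat \<Rightarrow> (nat \<Rightarrow> complex) \<Rightarrow> (nat \<Rightarrow> complex) \<Rightarrow> nat \<Rightarrow> complex" where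
  "contraction d M u \<psi> a = (\<Sum>c<d ^ M. cnj (product_vec d M (\<lambda>k. u) c) * \<psi> (a * d ^ M + c))"

lemma sum_sites_block: "(\<Sum>i<d ^ Suc (Suc M). f i) = (\<Sum>a<d ^ 2. \<Sum>c<d ^ M. f (a * d ^ M + c))" for d M :: nat
  using sum_block[of f "d ^ 2" "d ^ M"] by (simp add: power2_eq_square mult.assoc)

lemma inner_prod_product_vec_contraction:
  assumes "\<And>k. w (Suc (Suc k)) = u"
  shows "inner_prod (d ^ Suc (Suc M)) (product_vec d (Suc (Suc M)) w) \<psi>
    = antibilinear d (contraction d M u \<psi>) (w 0) (w 1)"
proof -
  have "inner_prod (d ^ Suc (Suc M)) (product_vec d (Suc (Suc M)) w) \<psi>
    = (\<Sum>a<d ^ 2. \<Sum>c<d ^ M. cnj (w 0 (a div d)) * cnj (w 1 (a mod d)) *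
        (cnj (product_vec d M (\<lambda>k. u) c) * \<psi> (a * d ^ M + c)))"
    unfolding inner_prod_def sum_sites_block
    by (intro sum.cong refl) (simp add: product_vec_block assms)
  also have "\<dots> = (\<Sum>a<d * d. cnj (w 0 (a div d)) * cnj (w 1 (a mod d)) * contraction d M u \<psi> a)"
    by (simp add: contraction_def sum_distrib_left power2_eq_square)
  also have "\<dots> = (\<Sum>x<d. \<Sum>y<d. cnj (w 0 x) * cnj (w 1 y) * contraction d M u \<psi> (x * d + y))"
    unfolding sum_block by (intro sum.cong refl) simp
  finally show ?thesis by (simp add: antibilinear_def)
qed

definition tensor_square :: "nat \<Rightarrow> (nat \<Rightarrow> complex) \<Rightarrow> nat \<Rightarrow> complex" where
  "tensor_square d u a = u (a div d) * u (a mod d)"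

text \<open>This is \<open>Z\<close> tensored with the identity on the last \<open>M\<close> sites.
  It need not preserve the symmetric subspace, which is why only the eigenvalue equation of the
  compression is available.\<close>

definition two_site_op :: "nat \<Rightarrow> nat \<Rightarrow> (nat \<Rightarrow> nat \<Rightarrow> complex) \<Rightarrow> nat \<Rightarrow> nat \<Rightarrow> complex" where
  "two_site_op d M Z i j = (if i mod d ^ M = j mod d ^ M then Z (i div d ^ M) (j div d ^ M) else 0)"

lemma apply_two_site_op:
  assumes "a < d ^ 2" "c < d ^ M"
  shows "apply_op (d ^ Suc (Suc M)) (two_site_op d M Z) \<psi> (a * d ^ M + c)
    = (\<Sum>b<d ^ 2. Z a b * \<psi> (b * d ^ M + c))"
proof -
  have "a * d ^ M + c < d ^ Suc (Suc M)" using assms by (rule block_index_less)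
  hence "apply_op (d ^ Suc (Suc M)) (two_site_op d M Z) \<psi> (a * d ^ M + c)
    = (\<Sum>b<d ^ 2. \<Sum>c'<d ^ M. two_site_op d M Z (a * d ^ M + c) (b * d ^ M + c') * \<psi> (b * d ^ M + c'))"
    unfolding apply_op_def sum_sites_block by simp
  also have "\<dots> = (\<Sum>b<d ^ 2. \<Sum>c'<d ^ M. if c' = c then Z a b * \<psi> (b * d ^ M + c') else 0)"
    using assms(2) by (intro sum.cong refl) (auto simp: two_site_op_def block_div_less block_mod_less)
  finally show ?thesis using assms(2) by simp
qed

text \<open>The inner sum is the entry \<open>(b, a)\<close> of the two-site partial trace of the
  dyad of \<open>\<psi>\<close> and \<open>\<phi>\<close>; in this form the expectation can be
  matched with \<open>marginal\<close>.\<close>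

lemma inner_prod_two_site_op:
  "inner_prod (d ^ Suc (Suc M)) \<phi> (apply_op (d ^ Suc (Suc M)) (two_site_op d M Z) \<psi>)
    = (\<Sum>a<d ^ 2. \<Sum>b<d ^ 2. Z a b * (\<Sum>c<d ^ M. cnj (\<phi> (a * d ^ M + c)) * \<psi> (b * d ^ M + c)))"
proof -
  have "inner_prod (d ^ Suc (Suc M)) \<phi> (apply_op (d ^ Suc (Suc M)) (two_site_op d M Z) \<psi>)
    = (\<Sum>a<d ^ 2. \<Sum>c<d ^ M. \<Sum>b<d ^ 2. Z a b * (cnj (\<phi> (a * d ^ M + c)) * \<psi> (b * d ^ M + c)))"
    unfolding inner_prod_def sum_sites_block
    by (intro sum.cong refl) (simp only: apply_two_site_op lessThan_iff sum_distrib_left mult_ac)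
  also have "\<dots> = (\<Sum>a<d ^ 2. \<Sum>b<d ^ 2. \<Sum>c<d ^ M. Z a b * (cnj (\<phi> (a * d ^ M + c)) * \<psi> (b * d ^ M + c)))"
    by (intro sum.cong refl sum.swap)
  finally show ?thesis by (simp add: sum_distrib_left)
qed

lemma herm_two_site_op:
  assumes "herm (d ^ 2) Z"
  shows "herm (d ^ Suc (Suc M)) (two_site_op d M Z)"
  unfolding herm_def
proof (intro allI impI)
  fix i j assume ij: "i < d ^ Suc (Suc M)" "j < d ^ Suc (Suc M)"
  have "k div d ^ M < d ^ 2" if "k < d ^ Suc (Suc M)" for k
    using that by (intro less_mult_imp_div_less) (simp add: power2_eq_square mult.assoc)
  hence "Z (i div d ^ M) (j div d ^ M) = cnj (Z (j div d ^ M) (i div d ^ M))"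
    using assms ij unfolding herm_def by blast
  thus "two_site_op d M Z i j = cnj (two_site_op d M Z j i)"
    by (auto simp: two_site_op_def)
qed

section \<open>The symmetric subspace and the two-body bound\<close>

definition sym_space :: "nat \<Rightarrow> nat \<Rightarrow> (nat \<Rightarrow> complex) set" where
  "sym_space d N = {x. (\<forall>i\<ge>d ^ N. x i = 0) \<and> symmetric d N x}"

lemma closed_subspace_sym_space: "closed_subspace (d ^ N) (sym_space d N)"
proof -
  have "sym_space d N = (\<Inter>i\<in>{d ^ N..}. {x. x i = 0}) \<inter>
    (\<Inter>\<pi>\<in>{\<pi>. \<pi> permutes {..<N}}. \<Inter>i\<in>{..<d ^ N}. {x. x (permuted_index d N \<pi> i) = x i})"
    by (auto simp: sym_space_def symmetric_def)
  moreover have "closed {x::nat \<Rightarrow> complex. x i = 0}" for i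
    by (intro closed_Collect_eq continuous_on_coordinate continuous_on_const)
  moreover have "closed {x::nat \<Rightarrow> complex. x i = x j}" for i j
    by (intro closed_Collect_eq continuous_on_coordinate)
  ultimately have "closed (sym_space d N)" by (simp add: closed_INT closed_Int)
  thus ?thesis by (simp add: closed_subspace_def sym_space_def symmetric_def)
qed

lemma permuted_index_less: "0 < d \<Longrightarrow> permuted_index d N \<pi> i < d ^ N"
  unfolding permuted_index_def by (rule basis_index_less) (rule site_less)

lemma product_vec_in_sym_space:
  assumes "0 < d"
  shows "(\<lambda>i. if i < d ^ N then product_vec d N (\<lambda>k. u) i else 0) \<in> sym_space d N"
proof -
  have "product_vec d N (\<lambda>k. u) (permuted_index d N \<pi> i) = product_vec d N (\<lambda>k. u) i"
    if "\<pi> permutes {..<N}" for \<pi> i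
    using product_vec_permuted_index[OF assms that, of "\<lambda>k. u" i] by (simp add: comp_def)
  thus ?thesis using assms by (simp add: sym_space_def symmetric_def permuted_index_less)
qed

lemma ex_tensor_power_maximum:
  assumes "0 < d"
  obtains u where "u \<in> unit_sphere d"
    "\<And>w. w \<in> unit_sphere d \<Longrightarrow> cmod (inner_prod (d ^ N) (product_vec d N (\<lambda>k. w)) \<psi>)
      \<le> cmod (inner_prod (d ^ N) (product_vec d N (\<lambda>k. u)) \<psi>)"
proof -
  have "norm_sq d (\<lambda>i. if i = 0 then 1 else 0) = (\<Sum>i<d. if i = 0 then 1 else 0)"
    unfolding norm_sq_def by (intro sum.cong) auto
  hence "(\<lambda>i. if i = 0 then 1 else 0) \<in> unit_sphere d"
    using assms by (simp add: unit_sphere_def)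
  hence ne: "unit_sphere d \<noteq> {}" by blast
  have "continuous_on (unit_sphere d) (\<lambda>w. cmod (inner_prod (d ^ N) (product_vec d N (\<lambda>k. w)) \<psi>))"
    unfolding inner_prod_def product_vec_def
    by (intro continuous_on_sum continuous_on_mult continuous_on_norm continuous_on_cnj
        continuous_on_prod continuous_on_const continuous_on_coordinate)
  from continuous_attains_sup[OF compact_unit_sphere ne this] show thesis
    using that by blast
qed

text \<open>The vector \<open>u\<close> is chosen for its overlap with the top eigenvector, not for
  its expectation of \<open>Z\<close>. One pair \<open>u\<close>, \<open>K\<close> serves all
  symmetric \<open>\<phi>\<close>, because the right-hand factor is the top value
  \<open>\<mu>\<close> itself.\<close>

lemma two_body_hartree_bound:
  assumes "0 < d" and Z: "herm (d ^ 2) Z"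
  shows "\<exists>u K. u \<in> unit_sphere d \<and> norm_sq (d ^ 2) K \<le> (real d - 1) / (real M + 1)\<^sup>2 \<and>
    (\<forall>\<phi>\<in>sym_space d (Suc (Suc M)).
      Re (inner_prod (d ^ Suc (Suc M)) \<phi> (apply_op (d ^ Suc (Suc M)) (two_site_op d M Z) \<phi>))
      \<le> Re (inner_prod (d ^ 2) (tensor_square d u) (apply_op (d ^ 2) Z (\<lambda>a. tensor_square d u a + K a)))
          * norm_sq (d ^ Suc (Suc M)) \<phi>)"
proof -
  define N where "N = Suc (Suc M)"
  let ?A = "two_site_op d M Z"
  let ?g = "\<lambda>\<psi> w. inner_prod (d ^ N) (product_vec d N (\<lambda>k. w)) \<psi>"
  \<comment> \<open>Any tensor power of a vector without zero entries would do as witness that the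
    symmetric subspace is nonzero.\<close>
  define x0 where "x0 = (\<lambda>i. if i < d ^ N then product_vec d N (\<lambda>k i. 1) i else 0)"
  have "x0 \<in> sym_space d N" unfolding x0_def using assms(1) by (rule product_vec_in_sym_space)
  moreover have "norm_sq (d ^ N) x0 \<noteq> 0"
    using assms(1) by (simp add: norm_sq_def x0_def product_vec_def)
  moreover have "herm (d ^ N) ?A" unfolding N_def using Z by (rule herm_two_site_op)
  ultimately obtain \<mu> \<psi> where \<psi>: "\<psi> \<in> sym_space d N" "norm_sq (d ^ N) \<psi> = 1"
    and top: "\<And>\<phi>. \<phi> \<in> sym_space d N \<Longrightarrow> Re (inner_prod (d ^ N) \<phi> (apply_op (d ^ N) ?A \<phi>)) \<le> \<mu> * norm_sq (d ^ N) \<phi>"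
    and eig: "\<And>\<phi>. \<phi> \<in> sym_space d N \<Longrightarrow> inner_prod (d ^ N) \<phi> (apply_op (d ^ N) ?A \<psi>) = complex_of_real \<mu> * inner_prod (d ^ N) \<phi> \<psi>"
    using compression_top_eigenvector[OF _ closed_subspace_sym_space, of d N ?A x0] by blast
  have sym: "symmetric d N \<psi>" using \<psi>(1) by (simp add: sym_space_def)
  obtain u where u: "u \<in> unit_sphere d"
    and max: "\<And>w. w \<in> unit_sphere d \<Longrightarrow> cmod (?g \<psi> w) \<le> cmod (?g \<psi> u)"
    using ex_tensor_power_maximum[OF assms(1)] by blast
  have u1: "norm_sq d u = 1" using u by (simp add: unit_sphere_def)
  define c where "c = ?g \<psi> u"
  \<comment> \<open>Were the maximal overlap zero, \<open>\<psi>\<close> would be orthogonal to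
    every tensor power, and symmetric tensors are determined by these overlaps.\<close>
  have "c \<noteq> 0"
  proof
    assume "c = 0"
    have "?g \<psi> w = 0" for w
    proof -
      have "(cmod (?g \<psi> w))\<^sup>2 \<le> 0\<^sup>2 * norm_sq d w ^ N"
        by (rule tensor_power_maximum_homogeneous) (use assms(1) max \<open>c = 0\<close> in \<open>auto simp: c_def N_def\<close>)
      thus ?thesis by simp
    qed
    hence "\<psi> j = 0" if "j < d ^ N" for j
      using symmetric_eq_0[OF assms(1) sym _ that] by blast
    thus False using \<psi>(2) by (simp add: norm_sq_def)
  qed
  define T where "T = contraction d M u \<psi>"
  have contr: "inner_prod (d ^ N) (product_vec d N w) \<psi> = antibilinear d T (w 0) (w 1)"
    if "\<And>k. w (Suc (Suc k)) = u" for w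
    unfolding N_def T_def using that by (rule inner_prod_product_vec_contraction)
  have Tuu: "antibilinear d T u u = c" using contr[of "\<lambda>k. u"] by (simp add: c_def)
  have Tsym: "antibilinear d T v w = antibilinear d T w v" for v w
  proof -
    let ?f = "\<lambda>k::nat. if k = 0 then v else if k = 1 then w else u"
    have "Transposition.transpose 0 1 permutes {..<N}" by (rule permutes_swap_id) (simp_all add: N_def)
    from inner_prod_product_vec_permute[OF assms(1) sym this, of ?f]
    show ?thesis using contr[of ?f] contr[of "?f \<circ> Transposition.transpose 0 1"] by simp
  qed
  have T1: "antibilinear d T v u = 0" and T2: "cmod (antibilinear d T v v) \<le> cmod c * (norm_sq d v / (real N - 1))"
    if "inner_prod d u v = 0" for v
  proof -
    have N2: "2 \<le> N" by (simp add: N_def)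
    note m = mixed_form_at_maximum[OF assms(1) N2 sym u c_def \<open>c \<noteq> 0\<close> _ that]
    have "mixed_form d N \<psi> u v 1 = antibilinear d T v u"
      unfolding mixed_form_def by (subst contr) auto
    thus "antibilinear d T v u = 0" using m(1) max by (simp add: c_def)
    have "mixed_form d N \<psi> u v 2 = antibilinear d T v v"
      unfolding mixed_form_def by (subst contr) auto
    thus "cmod (antibilinear d T v v) \<le> cmod c * (norm_sq d v / (real N - 1))"
      using m(2) max by (simp add: c_def)
  qed
  define K where "K = (\<lambda>a. T a / c - tensor_square d u a)"
  have K: "antibilinear d K v w = antibilinear d T v w / c - inner_prod d v u * inner_prod d w u" for v w
  proof -
    have "antibilinear d K v w = (\<Sum>x<d. \<Sum>y<d. cnj (v x) * cnj (w y) * T (x * d + y) / c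
        - (cnj (v x) * u x) * (cnj (w y) * u y))"
      unfolding antibilinear_def K_def tensor_square_def
      by (intro sum.cong refl) (auto simp: algebra_simps)
    thus ?thesis
      by (simp add: sum_subtractf antibilinear_def sum_divide_distrib inner_prod_def sum_product)
  qed
  have "norm_sq (d ^ 2) K \<le> (1 / (real N - 1))\<^sup>2 * (real d - 1)"
  proof (rule antibilinear_frobenius_bound[OF _ u1])
    show "0 < 1 / (real N - 1)" by (simp add: N_def)
    show "antibilinear d K v w = antibilinear d K w v" for v w
      unfolding K using Tsym[of v w] by simp
    \<comment> \<open>After removal of the component of \<open>w\<close> along \<open>u\<close> the
      first-order condition applies; on the component itself \<open>T / c\<close> and
      \<open>u \<otimes> u\<close> agree.\<close>
    show "antibilinear d K u w = 0" for w
    proof -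
      let ?\<alpha> = "inner_prod d u w"
      let ?w = "\<lambda>i. w i - ?\<alpha> * u i"
      have "inner_prod d u ?w = 0"
        by (simp add: inner_prod_diff_right inner_prod_scale_right inner_prod_self u1)
      hence "antibilinear d T u ?w = 0" using T1 Tsym by metis
      hence "antibilinear d T u w = cnj ?\<alpha> * c"
        by (simp add: antibilinear_diff_right antibilinear_scale_right Tuu)
      thus ?thesis unfolding K using \<open>c \<noteq> 0\<close> by (simp add: inner_prod_self u1 inner_prod_cnj)
    qed
    show "cmod (antibilinear d K v v) \<le> 1 / (real N - 1) * norm_sq d v" if "inner_prod d u v = 0" for v
    proof -
      have "inner_prod d v u = 0" using that inner_prod_cnj[of d u v] by simp
      hence "cmod (antibilinear d K v v) = cmod (antibilinear d T v v) / cmod c"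
        unfolding K by (simp add: norm_divide)
      also have "\<dots> \<le> norm_sq d v / (real N - 1)"
        using T2[OF that] \<open>c \<noteq> 0\<close> by (simp add: pos_divide_le_eq mult.commute)
      finally show ?thesis by simp
    qed
  qed
  hence Knorm: "norm_sq (d ^ 2) K \<le> (real d - 1) / (real M + 1)\<^sup>2"
    by (simp add: N_def power_divide add.commute)
  have \<mu>: "\<mu> = Re (inner_prod (d ^ 2) (tensor_square d u) (apply_op (d ^ 2) Z (\<lambda>a. tensor_square d u a + K a)))"
  proof -
    \<comment> \<open>The tensor power of \<open>u\<close> is an admissible test vector for the
      compressed equation. Its last \<open>M\<close> factors turn \<open>\<psi>\<close> into the
      contraction \<open>T\<close>, while its first two remain on the left of
      \<open>Z\<close>.\<close>
    define U where "U = (\<lambda>i. if i < d ^ N then product_vec d N (\<lambda>k. u) i else 0)"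
    have Ug: "inner_prod (d ^ N) U x = ?g x u" for x by (simp add: U_def inner_prod_def)
    have "U \<in> sym_space d N" unfolding U_def using assms(1) by (rule product_vec_in_sym_space)
    from eig[OF this] have "\<mu> * c = ?g (apply_op (d ^ N) ?A \<psi>) u" by (simp add: Ug c_def)
    also have "\<dots> = (\<Sum>a<d ^ 2. \<Sum>b<d ^ 2. Z a b *
        (\<Sum>k<d ^ M. cnj (product_vec d N (\<lambda>k. u) (a * d ^ M + k)) * \<psi> (b * d ^ M + k)))"
      unfolding N_def by (rule inner_prod_two_site_op)
    also have "\<dots> = (\<Sum>a<d ^ 2. \<Sum>b<d ^ 2. cnj (tensor_square d u a) * Z a b * T b)"
    proof (intro sum.cong refl)
      fix a b assume "a \<in> {..<d ^ 2}"
      hence "(\<Sum>k<d ^ M. cnj (product_vec d N (\<lambda>k. u) (a * d ^ M + k)) * \<psi> (b * d ^ M + k))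
        = (\<Sum>k<d ^ M. cnj (tensor_square d u a) * (cnj (product_vec d M (\<lambda>k. u) k) * \<psi> (b * d ^ M + k)))"
        unfolding N_def by (intro sum.cong refl) (simp add: product_vec_block tensor_square_def)
      also have "\<dots> = cnj (tensor_square d u a) * T b"
        by (simp add: T_def contraction_def sum_distrib_left)
      finally show "Z a b * (\<Sum>k<d ^ M. cnj (product_vec d N (\<lambda>k. u) (a * d ^ M + k)) * \<psi> (b * d ^ M + k))
        = cnj (tensor_square d u a) * Z a b * T b" by simp
    qed
    also have "\<dots> = inner_prod (d ^ 2) (tensor_square d u) (apply_op (d ^ 2) Z T)"
      by (simp add: inner_prod_apply_op)
    also have "T = (\<lambda>a. c * (tensor_square d u a + K a))"
      using \<open>c \<noteq> 0\<close> by (auto simp: K_def field_simps)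
    finally have "c * complex_of_real \<mu>
      = c * inner_prod (d ^ 2) (tensor_square d u) (apply_op (d ^ 2) Z (\<lambda>a. tensor_square d u a + K a))"
      unfolding apply_op_scale inner_prod_scale_right by (simp add: mult.commute)
    hence "complex_of_real \<mu> = inner_prod (d ^ 2) (tensor_square d u) (apply_op (d ^ 2) Z (\<lambda>a. tensor_square d u a + K a))"
      using \<open>c \<noteq> 0\<close> by simp
    thus ?thesis by (metis Re_complex_of_real)
  qed
  show ?thesis
    unfolding N_def[symmetric] \<mu>[symmetric]
    by (intro exI[of _ u] exI[of _ K] conjI ballI u Knorm) (simp only: \<mu>[symmetric] top)
qed

section \<open>Marginals of symmetric states\<close>

lemma herm_marginal:
  assumes \<sigma>: "\<sigma> \<in> density_operators_Sym d (Suc (Suc M))"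
  shows "herm (d ^ 2) (\<lambda>a b. marginal d (Suc (Suc M)) 2 \<sigma> $$ (a, b))"
  unfolding herm_def
proof (intro allI impI)
  fix a b assume ab: "a < d ^ 2" "b < d ^ 2"
  have "herm (d ^ Suc (Suc M)) (\<lambda>i j. \<sigma> $$ (i, j))"
    using \<sigma> unfolding density_operators_Sym_def density_operators_def positive_semidefinite_def
    by (intro herm_mat_adjoint) auto
  hence "\<sigma> $$ (a * d ^ M + c, b * d ^ M + c) = cnj (\<sigma> $$ (b * d ^ M + c, a * d ^ M + c))"
    if "c < d ^ M" for c
    using block_index_less[OF ab(1) that] block_index_less[OF ab(2) that] unfolding herm_def by blast
  hence "(\<Sum>c<d ^ M. \<sigma> $$ (a * d ^ M + c, b * d ^ M + c)) = (\<Sum>c<d ^ M. cnj (\<sigma> $$ (b * d ^ M + c, a * d ^ M + c)))"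
    by (intro sum.cong refl) blast
  thus "marginal d (Suc (Suc M)) 2 \<sigma> $$ (a, b) = cnj (marginal d (Suc (Suc M)) 2 \<sigma> $$ (b, a))"
    using ab by (simp add: marginal_def)
qed

text \<open>An eigenvector with nonzero eigenvalue is a multiple of its own image, hence lies in the
  range and so in the symmetric subspace. Those with eigenvalue 0 escape this argument, whence the
  guard in the first property.\<close>

lemma density_operator_Sym_decomposition:
  assumes \<sigma>: "\<sigma> \<in> density_operators_Sym d N"
  obtains l :: "nat \<Rightarrow> real" and v where
    "\<And>i. i < d ^ N \<Longrightarrow> l i \<noteq> 0 \<Longrightarrow> v i \<in> sym_space d N"
    "\<And>i. i < d ^ N \<Longrightarrow> norm_sq (d ^ N) (v i) = 1"
    "\<And>i. i < d ^ N \<Longrightarrow> 0 \<le> l i" "(\<Sum>i<d ^ N. l i) = 1"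
    "\<And>a b. a < d ^ N \<Longrightarrow> b < d ^ N \<Longrightarrow> \<sigma> $$ (a, b) = (\<Sum>i<d ^ N. complex_of_real (l i) * v i a * cnj (v i b))"
proof -
  let ?n = "d ^ N"
  have carr: "\<sigma> \<in> carrier_mat ?n ?n" and adj: "mat_adjoint \<sigma> = \<sigma>"
    and psd: "\<And>x. x \<in> carrier_vec ?n \<Longrightarrow> 0 \<le> (\<sigma> *\<^sub>v x) \<bullet>c x"
    and tr: "mat_trace \<sigma> = 1"
    and supp: "\<And>x. x \<in> carrier_vec ?n \<Longrightarrow> \<sigma> *\<^sub>v x \<in> Sym d N"
    using \<sigma> unfolding density_operators_Sym_def density_operators_def positive_semidefinite_def by auto
  obtain v l where on: "orthonormal ?n ?n v"
    and ev: "\<And>i. i < ?n \<Longrightarrow> apply_op ?n (\<lambda>i j. \<sigma> $$ (i, j)) (v i) = (\<lambda>j. complex_of_real (l i) * v i j)"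
    and dec: "\<And>a b. a < ?n \<Longrightarrow> b < ?n \<Longrightarrow> \<sigma> $$ (a, b) = (\<Sum>i<?n. complex_of_real (l i) * v i a * cnj (v i b))"
    using hermitian_spectral_decomposition[OF herm_mat_adjoint[OF carr adj]] by blast
  have nrm: "norm_sq ?n (v i) = 1" if "i < ?n" for i
    using on that inner_prod_self[of ?n "v i"] unfolding orthonormal_def by simp
  have mv: "\<sigma> *\<^sub>v vec ?n (v i) = vec ?n (\<lambda>j. complex_of_real (l i) * v i j)" if "i < ?n" for i
  proof (rule eq_vecI)
    fix j assume "j < dim_vec (vec ?n (\<lambda>j. complex_of_real (l i) * v i j))"
    hence j: "j < ?n" by simp
    have "(\<sigma> *\<^sub>v vec ?n (v i)) $ j = apply_op ?n (\<lambda>i j. \<sigma> $$ (i, j)) (v i) j"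
      using carr j by (simp add: apply_op_def scalar_prod_def lessThan_atLeast0)
    thus "(\<sigma> *\<^sub>v vec ?n (v i)) $ j = vec ?n (\<lambda>j. complex_of_real (l i) * v i j) $ j"
      using j by (simp add: ev[OF that])
  qed (use carr in simp)
  have mem: "v i \<in> sym_space d N" if i: "i < ?n" and l: "l i \<noteq> 0" for i
  proof -
    have "v i j = 0" if "?n \<le> j" for j
      using fun_cong[OF ev[OF i], of j] that l by (simp add: apply_op_def)
    moreover have "v i (permuted_index d N \<pi> j) = v i j" if \<pi>: "\<pi> permutes {..<N}" and j: "j < ?n" for \<pi> j
    proof -
      have "d \<noteq> 0 \<or> N = 0" using j by (cases "d = 0"; cases "N = 0") (auto simp: zero_power)
      hence lt: "permuted_index d N \<pi> j < ?n"
        unfolding permuted_index_def by (intro basis_index_less) (auto simp: site_less)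
      have "vec ?n (\<lambda>j. complex_of_real (l i) * v i j) \<in> Sym d N"
        using supp[of "vec ?n (v i)"] mv[OF i] by simp
      hence "permute_sites d N \<pi> (vec ?n (\<lambda>j. complex_of_real (l i) * v i j)) $ j
        = vec ?n (\<lambda>j. complex_of_real (l i) * v i j) $ j"
        using \<pi> unfolding Sym_def by simp
      thus ?thesis using j lt l by (simp add: permute_sites_def permuted_index_def)
    qed
    ultimately show ?thesis by (simp add: sym_space_def symmetric_def)
  qed
  have pos: "0 \<le> l i" if i: "i < ?n" for i
  proof -
    have "(\<sigma> *\<^sub>v vec ?n (v i)) \<bullet>c vec ?n (v i) = l i * inner_prod ?n (v i) (v i)"
      unfolding mv[OF i]
      by (simp add: scalar_prod_def inner_prod_def lessThan_atLeast0 sum_distrib_left mult_ac)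
    also have "\<dots> = complex_of_real (l i)" using nrm[OF i] by (simp add: inner_prod_self)
    finally show ?thesis using psd[of "vec ?n (v i)"] by (simp add: less_eq_complex_def)
  qed
  have tot: "(\<Sum>i<?n. l i) = 1"
  proof -
    have "1 = (\<Sum>j<?n. \<sigma> $$ (j, j))" using tr carr by (simp add: mat_trace_def)
    also have "\<dots> = (\<Sum>j<?n. \<Sum>i<?n. complex_of_real (l i) * (cnj (v i j) * v i j))"
      by (intro sum.cong refl) (simp add: dec mult_ac)
    also have "\<dots> = (\<Sum>i<?n. \<Sum>j<?n. complex_of_real (l i) * (cnj (v i j) * v i j))"
      by (rule sum.swap)
    also have "\<dots> = (\<Sum>i<?n. complex_of_real (l i) * inner_prod ?n (v i) (v i))"
      by (simp add: inner_prod_def sum_distrib_left)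
    also have "\<dots> = complex_of_real (\<Sum>i<?n. l i)"
      using nrm by (simp add: inner_prod_self)
    finally have "complex_of_real 1 = complex_of_real (\<Sum>i<?n. l i)" by simp
    thus ?thesis unfolding of_real_eq_iff by simp
  qed
  show thesis by (rule that[OF mem nrm pos tot dec])
qed

text \<open>The left-hand side is the trace of \<open>Z\<close> times the marginal, a convex
  combination of expectations of the two-site operator in symmetric eigenvectors. The two-body bound
  is uniform over these, so averaging preserves it.\<close>

lemma marginal_hartree_bound:
  assumes d: "0 < d" and \<sigma>: "\<sigma> \<in> density_operators_Sym d (Suc (Suc M))" and Z: "herm (d ^ 2) Z"
  shows "\<exists>u K. u \<in> unit_sphere d \<and> norm_sq (d ^ 2) K \<le> (real d - 1) / (real M + 1)\<^sup>2 \<and>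
    Re (\<Sum>a<d ^ 2. \<Sum>b<d ^ 2. Z a b * marginal d (Suc (Suc M)) 2 \<sigma> $$ (b, a))
    \<le> Re (inner_prod (d ^ 2) (tensor_square d u) (apply_op (d ^ 2) Z (\<lambda>a. tensor_square d u a + K a)))"
proof -
  let ?n = "d ^ Suc (Suc M)"
  let ?A = "two_site_op d M Z"
  obtain u K where u: "u \<in> unit_sphere d" and K: "norm_sq (d ^ 2) K \<le> (real d - 1) / (real M + 1)\<^sup>2"
    and bound: "\<And>\<phi>. \<phi> \<in> sym_space d (Suc (Suc M)) \<Longrightarrow> Re (inner_prod ?n \<phi> (apply_op ?n ?A \<phi>))
      \<le> Re (inner_prod (d ^ 2) (tensor_square d u) (apply_op (d ^ 2) Z (\<lambda>a. tensor_square d u a + K a))) * norm_sq ?n \<phi>"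
    using two_body_hartree_bound[OF d Z, of M] by blast
  define \<mu> where "\<mu> = Re (inner_prod (d ^ 2) (tensor_square d u) (apply_op (d ^ 2) Z (\<lambda>a. tensor_square d u a + K a)))"
  obtain l v where v: "\<And>i. i < ?n \<Longrightarrow> l i \<noteq> 0 \<Longrightarrow> v i \<in> sym_space d (Suc (Suc M))"
    and nrm: "\<And>i. i < ?n \<Longrightarrow> norm_sq ?n (v i) = 1"
    and l: "\<And>i. i < ?n \<Longrightarrow> 0 \<le> l i" "(\<Sum>i<?n. l i) = 1"
    and dec: "\<And>a b. a < ?n \<Longrightarrow> b < ?n \<Longrightarrow> \<sigma> $$ (a, b) = (\<Sum>i<?n. complex_of_real (l i) * v i a * cnj (v i b))"
    by (rule density_operator_Sym_decomposition[OF \<sigma>]) (rule that)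
  have "(\<Sum>a<d ^ 2. \<Sum>b<d ^ 2. Z a b * marginal d (Suc (Suc M)) 2 \<sigma> $$ (b, a))
    = (\<Sum>a<d ^ 2. \<Sum>b<d ^ 2. \<Sum>i<?n. complex_of_real (l i) *
        (Z a b * (\<Sum>c<d ^ M. cnj (v i (a * d ^ M + c)) * v i (b * d ^ M + c))))"
  proof (intro sum.cong refl)
    fix a b assume ab: "a \<in> {..<d ^ 2}" "b \<in> {..<d ^ 2}"
    have "marginal d (Suc (Suc M)) 2 \<sigma> $$ (b, a) = (\<Sum>c<d ^ M. \<sigma> $$ (b * d ^ M + c, a * d ^ M + c))"
      using ab by (simp add: marginal_def)
    also have "\<dots> = (\<Sum>c<d ^ M. \<Sum>i<?n. complex_of_real (l i) * (cnj (v i (a * d ^ M + c)) * v i (b * d ^ M + c)))"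
      using ab block_index_less[of _ d _ M] by (intro sum.cong refl) (simp add: dec mult_ac del: power_Suc)
    also have "\<dots> = (\<Sum>i<?n. \<Sum>c<d ^ M. complex_of_real (l i) * (cnj (v i (a * d ^ M + c)) * v i (b * d ^ M + c)))"
      by (rule sum.swap)
    finally show "Z a b * marginal d (Suc (Suc M)) 2 \<sigma> $$ (b, a) = (\<Sum>i<?n. complex_of_real (l i) *
        (Z a b * (\<Sum>c<d ^ M. cnj (v i (a * d ^ M + c)) * v i (b * d ^ M + c))))"
      by (simp only: sum_distrib_left mult_ac)
  qed
  also have "\<dots> = (\<Sum>a<d ^ 2. \<Sum>i<?n. \<Sum>b<d ^ 2. complex_of_real (l i) *
        (Z a b * (\<Sum>c<d ^ M. cnj (v i (a * d ^ M + c)) * v i (b * d ^ M + c))))"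
    by (intro sum.cong refl sum.swap)
  also have "\<dots> = (\<Sum>i<?n. \<Sum>a<d ^ 2. \<Sum>b<d ^ 2. complex_of_real (l i) *
        (Z a b * (\<Sum>c<d ^ M. cnj (v i (a * d ^ M + c)) * v i (b * d ^ M + c))))"
    by (rule sum.swap)
  also have "\<dots> = (\<Sum>i<?n. complex_of_real (l i) * inner_prod ?n (v i) (apply_op ?n ?A (v i)))"
    unfolding inner_prod_two_site_op sum_distrib_left ..
  finally have "Re (\<Sum>a<d ^ 2. \<Sum>b<d ^ 2. Z a b * marginal d (Suc (Suc M)) 2 \<sigma> $$ (b, a))
    = (\<Sum>i<?n. l i * Re (inner_prod ?n (v i) (apply_op ?n ?A (v i))))"
    by simp
  also have "\<dots> \<le> (\<Sum>i<?n. l i * \<mu>)"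
  proof (rule sum_mono)
    fix i assume i: "i \<in> {..<?n}"
    show "l i * Re (inner_prod ?n (v i) (apply_op ?n ?A (v i))) \<le> l i * \<mu>"
    \<comment> \<open>Eigenvectors that may fail to be symmetric carry no weight.\<close>
    proof (cases "l i = 0")
      case False
      hence "Re (inner_prod ?n (v i) (apply_op ?n ?A (v i))) \<le> \<mu>"
        using bound[OF v[OF _ False]] nrm[of i] i unfolding \<mu>_def by (metis lessThan_iff mult.right_neutral)
      thus ?thesis using l(1)[of i] i by (intro mult_left_mono) auto
    qed simp
  qed
  also have "\<dots> = \<mu>" using l(2) by (simp flip: sum_distrib_right)
  finally show ?thesis unfolding \<mu>_def by (intro exI[of _ u] exI[of _ K] conjI u K)
qed

section \<open>Approximation by Hartree mixtures\<close>

definition hs_norm_sq :: "nat \<Rightarrow> (nat \<Rightarrow> nat \<Rightarrow> complex) \<Rightarrow> real" where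
  "hs_norm_sq n Y = (\<Sum>a<n. \<Sum>b<n. (cmod (Y a b))\<^sup>2)"

lemma hs_norm_sq_nonneg: "0 \<le> hs_norm_sq n Y"
  by (simp add: hs_norm_sq_def sum_nonneg)

lemma hs_norm_sq_add:
  "hs_norm_sq n (\<lambda>a b. X a b + Y a b)
    = hs_norm_sq n X + 2 * Re (\<Sum>a<n. \<Sum>b<n. cnj (X a b) * Y a b) + hs_norm_sq n Y"
proof -
  have "(cmod (x + y))\<^sup>2 = (cmod x)\<^sup>2 + 2 * Re (cnj x * y) + (cmod y)\<^sup>2" for x y
    unfolding cmod_power2 by (simp add: power2_eq_square algebra_simps)
  thus ?thesis by (simp add: hs_norm_sq_def sum.distrib sum_distrib_left)
qed

definition symmetrized_dyad :: "(nat \<Rightarrow> complex) \<Rightarrow> (nat \<Rightarrow> complex) \<Rightarrow> nat \<Rightarrow> nat \<Rightarrow> complex" where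
  "symmetrized_dyad p q a b = (p a * cnj (q b) + q a * cnj (p b)) / 2"

text \<open>The error left when \<open>R\<close> is approximated by a Hartree projector plus its
  correction dyad. The averaged defect is made small; the correction is only bounded.\<close>

definition defect :: "nat \<Rightarrow> (nat \<Rightarrow> nat \<Rightarrow> complex) \<Rightarrow> (nat \<Rightarrow> complex) \<Rightarrow> (nat \<Rightarrow> complex) \<Rightarrow> nat \<Rightarrow> nat \<Rightarrow> complex" where
  "defect d R u K a b = R a b - tensor_square d u a * cnj (tensor_square d u b)
     - symmetrized_dyad (tensor_square d u) K a b"

lemma norm_sq_tensor_square: "norm_sq (d ^ 2) (tensor_square d u) = (norm_sq d u)\<^sup>2"
proof -
  have "norm_sq (d ^ 2) (tensor_square d u) = (\<Sum>x<d. \<Sum>y<d. (cmod (tensor_square d u (x * d + y)))\<^sup>2)"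
    unfolding norm_sq_def power2_eq_square[of d] by (rule sum_block)
  also have "\<dots> = (\<Sum>x<d. \<Sum>y<d. (cmod (u x))\<^sup>2 * (cmod (u y))\<^sup>2)"
    by (intro sum.cong refl)
      (simp add: tensor_square_def norm_mult power_mult_distrib block_div_less block_mod_less)
  finally show ?thesis by (simp add: norm_sq_def power2_eq_square[of "sum _ _"] sum_product)
qed

lemma herm_defect: "herm n R \<Longrightarrow> herm n (defect d R u K)"
  unfolding herm_def
proof (intro allI impI)
  fix a b assume "\<forall>i<n. \<forall>j<n. R i j = cnj (R j i)" "a < n" "b < n"
  hence "R a b = cnj (R b a)" by blast
  thus "defect d R u K a b = cnj (defect d R u K b a)"
    by (simp add: defect_def symmetrized_dyad_def add.commute mult.commute)
qed

lemma herm_sum: "(\<And>j. j \<in> J \<Longrightarrow> herm n (Y j)) \<Longrightarrow> herm n (\<lambda>a b. \<Sum>j\<in>J. Y j a b)"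
  unfolding herm_def cnj_sum by (intro allI impI sum.cong refl) blast

lemma inner_dyad:
  "(\<Sum>a<n. \<Sum>b<n. Z b a * (p a * cnj (q b))) = inner_prod n q (apply_op n Z p)"
  unfolding inner_prod_apply_op by (subst sum.swap) (simp add: mult_ac)

text \<open>Since \<open>Z\<close> is Hermitian, its pairings with the two halves of the dyad are
  conjugate, and together they have the real part of the single \<open>K\<close> term. The spectral
  bound for \<open>Z\<close> thus says exactly that the defect has nonpositive inner product with
  \<open>Z\<close>.\<close>

lemma inner_defect:
  assumes Z: "herm (d ^ 2) Z"
  shows "Re (\<Sum>a<d ^ 2. \<Sum>b<d ^ 2. cnj (Z a b) * defect d R u K a b)
    = Re (\<Sum>a<d ^ 2. \<Sum>b<d ^ 2. Z a b * R b a)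
      - Re (inner_prod (d ^ 2) (tensor_square d u) (apply_op (d ^ 2) Z (\<lambda>a. tensor_square d u a + K a)))"
proof -
  let ?n = "d ^ 2" and ?t = "tensor_square d u"
  have "(\<Sum>a<?n. \<Sum>b<?n. cnj (Z a b) * defect d R u K a b) = (\<Sum>a<?n. \<Sum>b<?n. Z b a * R a b
      - Z b a * (?t a * cnj (?t b)) - Z b a * (?t a * cnj (K b)) / 2 - Z b a * (K a * cnj (?t b)) / 2)"
  proof (intro sum.cong refl)
    fix a b assume "a \<in> {..<?n}" "b \<in> {..<?n}"
    hence "Z b a = cnj (Z a b)" using Z unfolding herm_def by blast
    thus "cnj (Z a b) * defect d R u K a b = Z b a * R a b
      - Z b a * (?t a * cnj (?t b)) - Z b a * (?t a * cnj (K b)) / 2 - Z b a * (K a * cnj (?t b)) / 2"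
      by (simp add: defect_def symmetrized_dyad_def algebra_simps add_divide_distrib)
  qed
  also have "\<dots> = (\<Sum>a<?n. \<Sum>b<?n. Z b a * R a b) - inner_prod ?n ?t (apply_op ?n Z ?t)
      - inner_prod ?n K (apply_op ?n Z ?t) / 2 - inner_prod ?n ?t (apply_op ?n Z K) / 2"
    by (simp only: sum_subtractf sum_divide_distrib[symmetric] inner_dyad)
  also have "inner_prod ?n K (apply_op ?n Z ?t) = cnj (inner_prod ?n ?t (apply_op ?n Z K))"
    by (simp only: inner_prod_cnj herm_inner[OF Z])
  also have "(\<Sum>a<?n. \<Sum>b<?n. Z b a * R a b) = (\<Sum>a<?n. \<Sum>b<?n. Z a b * R b a)"
    by (rule sum.swap)
  finally show ?thesis by (simp add: apply_op_add inner_prod_add_right)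
qed

text \<open>The Frank-Wolfe iteration: at each step the new defect has nonpositive inner product with the sum of the
  previous ones, so the squared norm of the sum grows only linearly.\<close>

lemma frank_wolfe_defects:
  fixes \<kappa> :: real
  assumes "0 \<le> \<kappa>" and R: "herm (d ^ 2) R"
    and step: "\<And>Z. herm (d ^ 2) Z \<Longrightarrow> \<exists>u K. u \<in> unit_sphere d \<and> norm_sq (d ^ 2) K \<le> \<kappa>\<^sup>2 \<and>
      Re (\<Sum>a<d ^ 2. \<Sum>b<d ^ 2. Z a b * R b a)
      \<le> Re (inner_prod (d ^ 2) (tensor_square d u) (apply_op (d ^ 2) Z (\<lambda>a. tensor_square d u a + K a)))"
  shows "\<exists>us Ks. (\<forall>j<k. us j \<in> unit_sphere d \<and> norm_sq (d ^ 2) (Ks j) \<le> \<kappa>\<^sup>2) \<and>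
    hs_norm_sq (d ^ 2) (\<lambda>a b. \<Sum>j<k. defect d R (us j) (Ks j) a b)
      \<le> real k * (\<Sum>a<d ^ 2. \<Sum>b<d ^ 2. (cmod (R a b) + 1 + \<kappa>)\<^sup>2)"
proof (induction k)
  case 0
  show ?case by (simp add: hs_norm_sq_def)
next
  case (Suc k)
  let ?C = "\<Sum>a<d ^ 2. \<Sum>b<d ^ 2. (cmod (R a b) + 1 + \<kappa>)\<^sup>2"
  from Suc obtain us Ks where IH: "\<forall>j<k. us j \<in> unit_sphere d \<and> norm_sq (d ^ 2) (Ks j) \<le> \<kappa>\<^sup>2"
    "hs_norm_sq (d ^ 2) (\<lambda>a b. \<Sum>j<k. defect d R (us j) (Ks j) a b) \<le> real k * ?C"
    by blast
  \<comment> \<open>The accumulated defect itself serves as the next operator \<open>Z\<close>. It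
    is Hermitian, and no normalisation is required since the bound holds for every Hermitian
    \<open>Z\<close>.\<close>
  define Z where "Z = (\<lambda>a b. \<Sum>j<k. defect d R (us j) (Ks j) a b)"
  have Z: "herm (d ^ 2) Z" unfolding Z_def by (intro herm_sum herm_defect R)
  obtain u K where u: "u \<in> unit_sphere d" and K: "norm_sq (d ^ 2) K \<le> \<kappa>\<^sup>2"
    and le: "Re (\<Sum>a<d ^ 2. \<Sum>b<d ^ 2. Z a b * R b a)
      \<le> Re (inner_prod (d ^ 2) (tensor_square d u) (apply_op (d ^ 2) Z (\<lambda>a. tensor_square d u a + K a)))"
    using step[OF Z] by blast
  have t1: "cmod (tensor_square d u a) \<le> 1" if "a < d ^ 2" for a
  proof -
    show ?thesis
      using cmod_sq_le_norm_sq[OF that, of "tensor_square d u"] u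
      by (simp add: norm_sq_tensor_square unit_sphere_def)
  qed
  have K1: "cmod (K a) \<le> \<kappa>" if "a < d ^ 2" for a
  proof -
    have "(cmod (K a))\<^sup>2 \<le> \<kappa>\<^sup>2" using cmod_sq_le_norm_sq[OF that, of K] K by linarith
    thus ?thesis using assms(1) by (rule power2_le_imp_le)
  qed
  \<comment> \<open>Entries of \<open>u \<otimes> u\<close> are at most 1 and those of
    \<open>K\<close> at most \<open>\<kappa>\<close> in modulus, so \<open>?C\<close> is independent
    of the chosen pair and of \<open>k\<close>.\<close>
  have "hs_norm_sq (d ^ 2) (defect d R u K) \<le> ?C"
    unfolding hs_norm_sq_def
  proof (intro sum_mono power_mono)
    fix a b assume ab: "a \<in> {..<d ^ 2}" "b \<in> {..<d ^ 2}"
    let ?t = "tensor_square d u"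
    have 1: "cmod (?t a * cnj (?t b)) \<le> 1 * 1"
      unfolding norm_mult complex_mod_cnj using ab t1 by (intro mult_mono) auto
    have 2: "cmod (?t a * cnj (K b)) \<le> 1 * \<kappa>"
      unfolding norm_mult complex_mod_cnj using ab t1 K1 by (intro mult_mono) auto
    have 3: "cmod (K a * cnj (?t b)) \<le> \<kappa> * 1"
      unfolding norm_mult complex_mod_cnj using ab t1 K1 assms(1) by (intro mult_mono) auto
    have "cmod (symmetrized_dyad ?t K a b) \<le> \<kappa>"
      unfolding symmetrized_dyad_def using norm_triangle_ineq[of "?t a * cnj (K b)" "K a * cnj (?t b)"] 2 3
      by (simp add: norm_divide)
    thus "cmod (defect d R u K a b) \<le> cmod (R a b) + 1 + \<kappa>"
      unfolding defect_def using 1 norm_triangle_ineq4[of "R a b" "?t a * cnj (?t b)"]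
        norm_triangle_ineq4[of "R a b - ?t a * cnj (?t b)" "symmetrized_dyad ?t K a b"]
      by linarith
  qed simp
  moreover have "Re (\<Sum>a<d ^ 2. \<Sum>b<d ^ 2. cnj (Z a b) * defect d R u K a b) \<le> 0"
    using le by (simp only: inner_defect[OF Z])
  ultimately have "hs_norm_sq (d ^ 2) (\<lambda>a b. Z a b + defect d R u K a b) \<le> real k * ?C + ?C"
    unfolding hs_norm_sq_add using IH(2) unfolding Z_def[symmetric] by linarith
  also have "(\<lambda>a b. Z a b + defect d R u K a b)
    = (\<lambda>a b. \<Sum>j<Suc k. defect d R ((us(k := u)) j) ((Ks(k := K)) j) a b)"
    by (simp add: Z_def fun_eq_iff)
  also have "real k * ?C + ?C = real (Suc k) * ?C" by (simp only: of_nat_Suc distrib_right mult_1 add.commute)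
  finally show ?case
    using IH(1) u K by (intro exI[of _ "us(k := u)"] exI[of _ "Ks(k := K)"] conjI) (simp_all add: less_Suc_eq)
qed

section \<open>Trace norm estimates through expectations in an eigenbasis\<close>

lemma parseval:
  assumes "orthonormal n n v"
  shows "(\<Sum>i<n. (cmod (inner_prod n (v i) x))\<^sup>2) = norm_sq n x"
proof -
  have "complex_of_real (\<Sum>i<n. (cmod (inner_prod n (v i) x))\<^sup>2)
    = (\<Sum>i<n. inner_prod n (v i) x * cnj (inner_prod n (v i) x))"
    by (simp only: of_real_sum complex_norm_square)
  also have "\<dots> = (\<Sum>i<n. \<Sum>a<n. \<Sum>b<n. cnj (v i a) * v i b * (x a * cnj (x b)))"
    by (simp add: inner_prod_def sum_product mult_ac)
  also have "\<dots> = (\<Sum>a<n. \<Sum>i<n. \<Sum>b<n. cnj (v i a) * v i b * (x a * cnj (x b)))"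
    by (rule sum.swap)
  also have "\<dots> = (\<Sum>a<n. \<Sum>b<n. \<Sum>i<n. cnj (v i a) * v i b * (x a * cnj (x b)))"
    by (intro sum.cong refl sum.swap)
  also have "\<dots> = (\<Sum>a<n. \<Sum>b<n. if b = a then x a * cnj (x b) else 0)"
    using orthonormal_complete[OF assms]
    by (intro sum.cong refl) (simp add: sum_distrib_right[symmetric])
  also have "\<dots> = complex_of_real (norm_sq n x)"
    unfolding norm_sq_def of_real_sum complex_norm_square by simp
  finally show ?thesis unfolding of_real_eq_iff .
qed

text \<open>Each expectation is at most the product of the overlaps with \<open>p\<close> and
  \<open>q\<close>. The arithmetic-geometric mean inequality with weight \<open>\<kappa>\<close> and
  Parseval bound the sum by two halves of size \<open>\<kappa> / 2\<close>. The basis is arbitrary,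
  so the dyad need not be diagonalised.\<close>

lemma sum_dyad_expectation_le:
  assumes v: "orthonormal n n v" and "0 < \<kappa>" "norm_sq n p = 1" "norm_sq n q \<le> \<kappa>\<^sup>2"
  shows "(\<Sum>i<n. cmod (inner_prod n (v i) (apply_op n (symmetrized_dyad p q) (v i)))) \<le> \<kappa>"
proof -
  have "cmod (inner_prod n (v i) (apply_op n (symmetrized_dyad p q) (v i)))
    \<le> (\<kappa> * (cmod (inner_prod n (v i) p))\<^sup>2 + (cmod (inner_prod n (v i) q))\<^sup>2 / \<kappa>) / 2" for i
  proof -
    let ?p = "inner_prod n (v i) p" and ?q = "inner_prod n (v i) q"
    have "inner_prod n (v i) (apply_op n (symmetrized_dyad p q) (v i))
      = (\<Sum>a<n. \<Sum>b<n. (cnj (v i a) * p a) * (cnj (q b) * v i b) / 2 + (cnj (v i a) * q a) * (cnj (p b) * v i b) / 2)"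
      unfolding inner_prod_apply_op symmetrized_dyad_def
      by (intro sum.cong refl) (simp add: field_simps)
    also have "\<dots> = (?p * inner_prod n q (v i) + ?q * inner_prod n p (v i)) / 2"
      by (simp add: sum.distrib inner_prod_def sum_product sum_divide_distrib add_divide_distrib)
    also have "\<dots> = (?p * cnj ?q + ?q * cnj ?p) / 2" by (simp only: inner_prod_cnj)
    finally have eq: "inner_prod n (v i) (apply_op n (symmetrized_dyad p q) (v i))
      = (?p * cnj ?q + ?q * cnj ?p) / 2" .
    have "cmod (inner_prod n (v i) (apply_op n (symmetrized_dyad p q) (v i)))
      \<le> (cmod (?p * cnj ?q) + cmod (?q * cnj ?p)) / 2"
      unfolding eq norm_divide using norm_triangle_ineq[of "?p * cnj ?q" "?q * cnj ?p"] by simp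
    also have "\<dots> = cmod ?p * cmod ?q" by (simp add: norm_mult)
    also have "\<dots> \<le> (\<kappa> * (cmod ?p)\<^sup>2 + (cmod ?q)\<^sup>2 / \<kappa>) / 2"
    proof -
      have "0 \<le> (\<kappa> * cmod ?p - cmod ?q)\<^sup>2 / \<kappa>" using assms(2) by simp
      also have "\<dots> = \<kappa> * (cmod ?p)\<^sup>2 + (cmod ?q)\<^sup>2 / \<kappa> - 2 * (cmod ?p * cmod ?q)"
        using assms(2) by (simp add: field_simps power2_eq_square)
      finally show ?thesis by simp
    qed
    finally show ?thesis .
  qed
  hence "(\<Sum>i<n. cmod (inner_prod n (v i) (apply_op n (symmetrized_dyad p q) (v i))))
    \<le> (\<Sum>i<n. (\<kappa> * (cmod (inner_prod n (v i) p))\<^sup>2 + (cmod (inner_prod n (v i) q))\<^sup>2 / \<kappa>) / 2)"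
    by (intro sum_mono)
  also have "\<dots> = (\<kappa> * norm_sq n p + norm_sq n q / \<kappa>) / 2"
    by (simp only: sum_divide_distrib[symmetric] sum.distrib sum_distrib_left[symmetric] parseval[OF v])
  also have "\<dots> \<le> (\<kappa> * 1 + \<kappa>\<^sup>2 / \<kappa>) / 2"
    using assms by (intro divide_right_mono add_mono) (auto intro: divide_right_mono)
  also have "\<dots> = \<kappa>" using assms(2) by (simp add: power2_eq_square)
  finally show ?thesis .
qed

text \<open>All \<open>n ^ 3\<close> terms are bounded by the largest entry. So crude a factor is
  affordable because the averaged defect can be made arbitrarily small.\<close>

lemma sum_expectation_le_hs_norm:
  assumes v: "orthonormal n n v"
  shows "(\<Sum>i<n. cmod (inner_prod n (v i) (apply_op n Y (v i)))) \<le> real n ^ 3 * sqrt (hs_norm_sq n Y)"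
proof -
  have Y: "cmod (Y a b) \<le> sqrt (hs_norm_sq n Y)" if "a < n" "b < n" for a b
  proof -
    have "(cmod (Y a b))\<^sup>2 \<le> (\<Sum>b<n. (cmod (Y a b))\<^sup>2)"
      using that by (intro member_le_sum) auto
    also have "\<dots> \<le> hs_norm_sq n Y"
      unfolding hs_norm_sq_def using that
      by (intro member_le_sum[of a _ "\<lambda>a. \<Sum>b<n. (cmod (Y a b))\<^sup>2"]) (auto intro: sum_nonneg)
    finally show ?thesis by (simp add: real_le_rsqrt)
  qed
  have v1: "cmod (v i a) \<le> 1" if "i < n" "a < n" for i a
  proof -
    have "norm_sq n (v i) = 1" using v that inner_prod_self[of n "v i"] by (simp add: orthonormal_def)
    hence "(cmod (v i a))\<^sup>2 \<le> 1\<^sup>2" using cmod_sq_le_norm_sq[OF that(2), of "v i"] by simp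
    thus ?thesis by (rule power2_le_imp_le) simp
  qed
  have "cmod (inner_prod n (v i) (apply_op n Y (v i))) \<le> (\<Sum>a<n. \<Sum>b<n. 1 * sqrt (hs_norm_sq n Y) * 1)"
    if "i < n" for i
    unfolding inner_prod_apply_op
  proof (intro sum_norm_le)
    fix a b assume "a \<in> {..<n}" "b \<in> {..<n}"
    thus "cmod (cnj (v i a) * Y a b * v i b) \<le> 1 * sqrt (hs_norm_sq n Y) * 1"
      unfolding norm_mult complex_mod_cnj using Y v1 that by (intro mult_mono) (auto simp: hs_norm_sq_nonneg)
  qed
  hence "(\<Sum>i<n. cmod (inner_prod n (v i) (apply_op n Y (v i)))) \<le> (\<Sum>i<n. \<Sum>a<n. \<Sum>b<n. 1 * sqrt (hs_norm_sq n Y) * 1)"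
    by (intro sum_mono) auto
  thus ?thesis by (simp add: power3_eq_cube mult.assoc)
qed

text \<open>In an eigenbasis of \<open>X\<close> the trace norm is the sum of the moduli of the
  expectations of \<open>X\<close>. Expectations are linear, so defects and dyads can be estimated
  separately in this one basis, and the triangle inequality is needed only for complex
  numbers.\<close>

lemma trace_norm_average_defect_le:
  assumes "0 < k" "0 < \<kappa>" and R: "herm (d ^ 2) R"
    and us: "\<And>j. j < k \<Longrightarrow> us j \<in> unit_sphere d" and Ks: "\<And>j. j < k \<Longrightarrow> norm_sq (d ^ 2) (Ks j) \<le> \<kappa>\<^sup>2"
    and X: "X \<in> carrier_mat (d ^ 2) (d ^ 2)"
    and X_entry: "\<And>a b. a < d ^ 2 \<Longrightarrow> b < d ^ 2 \<Longrightarrow>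
      X $$ (a, b) = R a b - (\<Sum>j<k. complex_of_real (1 / real k) * (tensor_square d (us j) a * cnj (tensor_square d (us j) b)))"
  shows "trace_norm X \<le> \<kappa> + real (d ^ 2) ^ 3 *
    (sqrt (hs_norm_sq (d ^ 2) (\<lambda>a b. \<Sum>j<k. defect d R (us j) (Ks j) a b)) / real k)"
proof -
  let ?n = "d ^ 2"
  define Y where "Y = (\<lambda>a b. \<Sum>j<k. defect d R (us j) (Ks j) a b)"
  define G where "G = (\<lambda>j. symmetrized_dyad (tensor_square d (us j)) (Ks j))"
  \<comment> \<open>Adding the dyads back to the defects leaves \<open>R\<close> minus a projector
    in each of the \<open>k\<close> summands.\<close>
  have XY: "X $$ (a, b) = (Y a b + (\<Sum>j<k. G j a b)) / of_nat k" if "a < ?n" "b < ?n" for a b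
  proof -
    have "Y a b + (\<Sum>j<k. G j a b) = (\<Sum>j<k. R a b - tensor_square d (us j) a * cnj (tensor_square d (us j) b))"
      unfolding Y_def G_def defect_def sum.distrib[symmetric] by simp
    also have "\<dots> = of_nat k * R a b - (\<Sum>j<k. tensor_square d (us j) a * cnj (tensor_square d (us j) b))"
      by (simp add: sum_subtractf)
    finally show ?thesis
      using assms(1) by (simp add: X_entry[OF that] diff_divide_distrib sum_divide_distrib)
  qed
  have "X $$ (i, j) = cnj (X $$ (j, i))" if "i < ?n" "j < ?n" for i j
  proof -
    have "R i j = cnj (R j i)" using R that unfolding herm_def by blast
    thus ?thesis using that by (simp add: X_entry mult.commute)
  qed
  moreover have "mat_adjoint X $$ (i, j) = cnj (X $$ (j, i))" if "i < ?n" "j < ?n" for i j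
    using X that by (simp add: mat_adjoint_def mat_of_rows_def)
  ultimately have "mat_adjoint X $$ (i, j) = X $$ (i, j)" if "i < ?n" "j < ?n" for i j
    using that by metis
  hence adj: "mat_adjoint X = X"
    using X by (intro eq_matI) (auto simp: mat_adjoint_def)
  obtain v l where v: "orthonormal ?n ?n v"
    and ev: "\<And>i. i < ?n \<Longrightarrow> apply_op ?n (\<lambda>i j. X $$ (i, j)) (v i) = (\<lambda>j. complex_of_real (l i) * v i j)"
    and dec: "\<And>a b. a < ?n \<Longrightarrow> b < ?n \<Longrightarrow> X $$ (a, b) = (\<Sum>i<?n. complex_of_real (l i) * v i a * cnj (v i b))"
    using hermitian_spectral_decomposition[OF herm_mat_adjoint[OF X adj]] by blast
  have "trace_norm X = (\<Sum>i<?n. \<bar>l i\<bar>)"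
    by (rule trace_norm_hermitian[OF X adj v dec])
  also have "\<dots> \<le> (\<Sum>i<?n. (cmod (inner_prod ?n (v i) (apply_op ?n Y (v i)))
      + (\<Sum>j<k. cmod (inner_prod ?n (v i) (apply_op ?n (G j) (v i))))) / real k)"
  proof (rule sum_mono)
    fix i assume "i \<in> {..<?n}"
    hence i: "i < ?n" by simp
    have "inner_prod ?n (v i) (apply_op ?n (\<lambda>i j. X $$ (i, j)) (v i)) = l i"
      unfolding ev[OF i] inner_prod_scale_right using v i by (simp add: orthonormal_def)
    also have "inner_prod ?n (v i) (apply_op ?n (\<lambda>i j. X $$ (i, j)) (v i))
      = (\<Sum>a<?n. \<Sum>b<?n. (cnj (v i a) * Y a b * v i b + (\<Sum>j<k. cnj (v i a) * G j a b * v i b)) / of_nat k)"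
      unfolding inner_prod_apply_op
    proof (intro sum.cong refl)
      fix a b assume "a \<in> {..<?n}" "b \<in> {..<?n}"
      moreover have "(\<Sum>j<k. cnj (v i a) * G j a b * v i b) = cnj (v i a) * (\<Sum>j<k. G j a b) * v i b"
        by (simp only: sum_distrib_left sum_distrib_right)
      ultimately show "cnj (v i a) * X $$ (a, b) * v i b
        = (cnj (v i a) * Y a b * v i b + (\<Sum>j<k. cnj (v i a) * G j a b * v i b)) / of_nat k"
        by (simp add: XY distrib_left distrib_right)
    qed
    also have "\<dots> = (inner_prod ?n (v i) (apply_op ?n Y (v i))
        + (\<Sum>a<?n. \<Sum>b<?n. \<Sum>j<k. cnj (v i a) * G j a b * v i b)) / of_nat k"
      by (simp only: inner_prod_apply_op sum.distrib sum_divide_distrib[symmetric])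
    also have "(\<Sum>a<?n. \<Sum>b<?n. \<Sum>j<k. cnj (v i a) * G j a b * v i b)
      = (\<Sum>a<?n. \<Sum>j<k. \<Sum>b<?n. cnj (v i a) * G j a b * v i b)"
      by (intro sum.cong refl sum.swap)
    also have "\<dots> = (\<Sum>j<k. inner_prod ?n (v i) (apply_op ?n (G j) (v i)))"
      unfolding inner_prod_apply_op by (rule sum.swap)
    finally have eq: "(inner_prod ?n (v i) (apply_op ?n Y (v i))
        + (\<Sum>j<k. inner_prod ?n (v i) (apply_op ?n (G j) (v i)))) / of_nat k = complex_of_real (l i)" .
    have "\<bar>l i\<bar> = cmod ((inner_prod ?n (v i) (apply_op ?n Y (v i))
        + (\<Sum>j<k. inner_prod ?n (v i) (apply_op ?n (G j) (v i)))) / of_nat k)"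
      unfolding eq norm_of_real ..
    also have "\<dots> \<le> (cmod (inner_prod ?n (v i) (apply_op ?n Y (v i)))
        + (\<Sum>j<k. cmod (inner_prod ?n (v i) (apply_op ?n (G j) (v i))))) / real k"
      unfolding norm_divide norm_of_nat
      by (intro divide_right_mono norm_triangle_mono norm_sum order_refl) simp
    finally show "\<bar>l i\<bar> \<le> \<dots>" .
  qed
  also have "\<dots> = ((\<Sum>i<?n. cmod (inner_prod ?n (v i) (apply_op ?n Y (v i))))
      + (\<Sum>j<k. \<Sum>i<?n. cmod (inner_prod ?n (v i) (apply_op ?n (G j) (v i))))) / real k"
    unfolding sum_divide_distrib[symmetric] sum.distrib by (subst (2) sum.swap) (rule refl)
  also have "\<dots> \<le> (real ?n ^ 3 * sqrt (hs_norm_sq ?n Y) + (\<Sum>j<k. \<kappa>)) / real k"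
  proof (intro divide_right_mono add_mono sum_mono)
    show "(\<Sum>i<?n. cmod (inner_prod ?n (v i) (apply_op ?n Y (v i)))) \<le> real ?n ^ 3 * sqrt (hs_norm_sq ?n Y)"
      by (rule sum_expectation_le_hs_norm[OF v])
    fix j assume "j \<in> {..<k}"
    hence j: "j < k" by simp
    have "norm_sq ?n (tensor_square d (us j)) = 1"
      using us[OF j] by (simp add: norm_sq_tensor_square unit_sphere_def)
    thus "(\<Sum>i<?n. cmod (inner_prod ?n (v i) (apply_op ?n (G j) (v i)))) \<le> \<kappa>"
      unfolding G_def by (rule sum_dyad_expectation_le[OF v assms(2) _ Ks[OF j]])
  qed simp
  also have "\<dots> = \<kappa> + real ?n ^ 3 * (sqrt (hs_norm_sq ?n Y) / real k)"
    using assms(1) by (simp add: add_divide_distrib)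
  finally show ?thesis unfolding Y_def .
qed

section \<open>Hartree mixtures close to a marginal\<close>

lemma kron_projector_entry:
  assumes "a < d ^ 2" "b < d ^ 2"
  shows "kron (projector (vec d u)) (projector (vec d u)) $$ (a, b)
    = tensor_square d u a * cnj (tensor_square d u b)"
proof -
  have "i div d < d" "i mod d < d" if "i < d ^ 2" for i
  proof -
    show "i div d < d" using that by (simp add: less_mult_imp_div_less power2_eq_square)
    have "d > 0" using that by (cases d) auto
    thus "i mod d < d" by simp
  qed
  thus ?thesis
    using assms by (simp add: kron_def projector_def tensor_square_def power2_eq_square)
qed

lemma BOS2_near_SEP_H2:
  fixes e :: real
  assumes "2 \<le> d" and \<sigma>: "\<sigma> \<in> density_operators_Sym d (Suc (Suc M))" and "0 < e"
  shows "\<exists>\<tau>\<in>SEP_H2 d. trace_norm (marginal d (Suc (Suc M)) 2 \<sigma> - \<tau>) \<le> sqrt (real d - 1) / (real M + 1) + e"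
proof -
  let ?n = "d ^ 2" and ?\<rho> = "marginal d (Suc (Suc M)) 2 \<sigma>"
  define \<kappa> where "\<kappa> = sqrt (real d - 1) / (real M + 1)"
  define R where "R = (\<lambda>a b. ?\<rho> $$ (a, b))"
  define C where "C = (\<Sum>a<?n. \<Sum>b<?n. (cmod (R a b) + 1 + \<kappa>)\<^sup>2)"
  \<comment> \<open>Positivity, on which the weighted estimate for dyads relies, comes from
    \<open>d \<ge> 2\<close>.\<close>
  have \<kappa>: "0 < \<kappa>" "\<kappa>\<^sup>2 = (real d - 1) / (real M + 1)\<^sup>2"
    using assms(1) by (simp_all add: \<kappa>_def power_divide)
  have C: "0 \<le> C" by (simp add: C_def sum_nonneg)
  have R: "herm ?n R" unfolding R_def by (rule herm_marginal[OF \<sigma>])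
  \<comment> \<open>The average of \<open>k\<close> defects has Hilbert-Schmidt norm at most
    \<open>sqrt (C / k)\<close>, so this \<open>k\<close> brings its contribution, dimension factor
    included, below \<open>e\<close>; the summand 1 ensures \<open>k > 0\<close>.\<close>
  obtain k :: nat where k: "(real ?n ^ 3 * sqrt C / e)\<^sup>2 + 1 < real k"
    using reals_Archimedean2 by blast
  have k0: "0 < k" using k zero_le_power2[of "real ?n ^ 3 * sqrt C / e"] by linarith
  have small: "real ?n ^ 3 * (sqrt (real k * C) / real k) \<le> e"
  proof -
    have "real ?n ^ 3 * sqrt C / e \<le> sqrt (real k)"
      using k by (intro real_le_rsqrt) linarith
    hence "real ?n ^ 3 * sqrt C \<le> e * sqrt (real k)"
      using assms(3) by (simp add: pos_divide_le_eq mult.commute)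
    hence "real ?n ^ 3 * sqrt C / sqrt (real k) \<le> e"
      using k0 by (simp add: pos_divide_le_eq)
    moreover have "sqrt (real k * C) / real k = sqrt C / sqrt (real k)"
      using k0 by (simp add: real_sqrt_mult field_simps)
    ultimately show ?thesis by simp
  qed
  have step: "\<exists>u K. u \<in> unit_sphere d \<and> norm_sq ?n K \<le> \<kappa>\<^sup>2 \<and>
      Re (\<Sum>a<?n. \<Sum>b<?n. Z a b * R b a)
      \<le> Re (inner_prod ?n (tensor_square d u) (apply_op ?n Z (\<lambda>a. tensor_square d u a + K a)))"
    if "herm ?n Z" for Z
    unfolding \<kappa>(2) R_def using assms(1) by (intro marginal_hartree_bound[OF _ \<sigma> that]) simp
  obtain us Ks where us: "\<And>j. j < k \<Longrightarrow> us j \<in> unit_sphere d" and Ks: "\<And>j. j < k \<Longrightarrow> norm_sq ?n (Ks j) \<le> \<kappa>\<^sup>2"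
    and hs: "hs_norm_sq ?n (\<lambda>a b. \<Sum>j<k. defect d R (us j) (Ks j) a b) \<le> real k * C"
    using frank_wolfe_defects[OF less_imp_le[OF \<kappa>(1)] R step, of k] unfolding C_def by blast
  define P where "P = (\<lambda>j. kron (projector (vec d (us j))) (projector (vec d (us j))))"
  \<comment> \<open>Dropping the dyads from the average of the iterates leaves the projectors with
    equal weights.\<close>
  define \<tau> where "\<tau> = mat ?n ?n (\<lambda>(i, j). \<Sum>m<k. complex_of_real (1 / real k) * P m $$ (i, j))"
  have "P j \<in> {kron (projector u) (projector u) | u. u \<in> carrier_vec d \<and> u \<bullet>c u = 1}" if "j < k" for j
  proof -
    have "vec d (us j) \<bullet>c vec d (us j) = inner_prod d (us j) (us j)"
      by (simp add: scalar_prod_def inner_prod_def lessThan_atLeast0 mult.commute)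
    also have "\<dots> = 1" using us[OF that] by (simp add: inner_prod_self unit_sphere_def)
    finally show ?thesis unfolding P_def by (intro CollectI exI[of _ "vec d (us j)"]) simp
  qed
  moreover have "(\<Sum>m<k. 1 / real k) = 1" using k0 by simp
  ultimately have "\<tau> \<in> SEP_H2 d"
    unfolding SEP_H2_def mat_convex_hull_def \<tau>_def
    by (intro CollectI exI[of _ k] exI[of _ "\<lambda>_. 1 / real k"] exI[of _ P]) simp
  moreover have "trace_norm (?\<rho> - \<tau>) \<le> \<kappa> + real ?n ^ 3 *
    (sqrt (hs_norm_sq ?n (\<lambda>a b. \<Sum>j<k. defect d R (us j) (Ks j) a b)) / real k)"
  proof (rule trace_norm_average_defect_le[OF k0 \<kappa>(1) R us Ks])
    show "?\<rho> - \<tau> \<in> carrier_mat ?n ?n" by (auto simp: marginal_def \<tau>_def)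
    show "(?\<rho> - \<tau>) $$ (a, b) = R a b - (\<Sum>j<k. complex_of_real (1 / real k) *
        (tensor_square d (us j) a * cnj (tensor_square d (us j) b)))" if "a < ?n" "b < ?n" for a b
      using that by (simp add: \<tau>_def R_def P_def kron_projector_entry)
  qed
  moreover have "real ?n ^ 3 * (sqrt (hs_norm_sq ?n (\<lambda>a b. \<Sum>j<k. defect d R (us j) (Ks j) a b)) / real k)
      \<le> real ?n ^ 3 * (sqrt (real k * C) / real k)"
    using hs by (intro mult_left_mono divide_right_mono) simp_all
  ultimately show ?thesis using small unfolding \<kappa>_def by (intro bexI[of _ \<tau>]) auto
qed

theorem theorem1p1:
  fixes N d :: nat
  assumes "N \<ge> 2" and "d \<ge> 2"
  shows "(SUP \<rho>\<in>BOS2 d N. INF \<tau>\<in>SEP_H2 d. ereal (1 / 2 * trace_norm (\<rho> - \<tau>)))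
           \<le> ereal (sqrt (real d - 1) / (2 * (real N - 1)))"
proof (rule SUP_least)
  fix \<rho> assume "\<rho> \<in> BOS2 d N"
  obtain M where N: "N = Suc (Suc M)"
    using assms(1) that[of "N - 2"] by simp
  then obtain \<sigma> where \<sigma>: "\<sigma> \<in> density_operators_Sym d (Suc (Suc M))" "\<rho> = marginal d (Suc (Suc M)) 2 \<sigma>"
    using \<open>\<rho> \<in> BOS2 d N\<close> by (auto simp: BOS2_def)
  show "(INF \<tau>\<in>SEP_H2 d. ereal (1 / 2 * trace_norm (\<rho> - \<tau>))) \<le> ereal (sqrt (real d - 1) / (2 * (real N - 1)))"
  \<comment> \<open>The iteration leaves a positive but arbitrarily small excess. The infimum
    absorbs it, so no exact minimiser is sought.\<close>
  proof (rule ereal_le_epsilon2)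
    fix e :: real assume "0 < e"
    then obtain \<tau> where \<tau>: "\<tau> \<in> SEP_H2 d" "trace_norm (\<rho> - \<tau>) \<le> sqrt (real d - 1) / (real M + 1) + e"
      using BOS2_near_SEP_H2[OF assms(2) \<sigma>(1)] \<sigma>(2) by blast
    define s where "s = sqrt (real d - 1) / (real M + 1)"
    have "sqrt (real d - 1) / (2 * (real N - 1)) = s / 2" by (simp add: N s_def field_simps)
    moreover have "1 / 2 * trace_norm (\<rho> - \<tau>) \<le> s / 2 + e"
      using \<tau>(2) \<open>0 < e\<close> unfolding s_def[symmetric] by linarith
    ultimately have "1 / 2 * trace_norm (\<rho> - \<tau>) \<le> sqrt (real d - 1) / (2 * (real N - 1)) + e" by simp
    with \<tau>(1) show "(INF \<tau>\<in>SEP_H2 d. ereal (1 / 2 * trace_norm (\<rho> - \<tau>)))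
        \<le> ereal (sqrt (real d - 1) / (2 * (real N - 1))) + ereal e"
      by (intro INF_lower2[of \<tau>]) simp_all
  qed
qed

end
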